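(* Let $L>0$ and let $\mathbb T^2=\mathbb R^2/(\mathbb Z\times L\mathbb Z)$ with coordinates $(x,y)$. Consider a magnetic system $(g,b)$ on $\mathbb T^2$ of the form $$g=\mathrm dx^2+a(x)^2\,\mathrm dy^2,\qquad b=b(x),$$ where $a:\mathbb R/\mathbb Z\to(0,\infty)$ and $b:\mathbb R/\mathbb Z\to\mathbb R$ are smooth functions of the $x$-variable only. If $$\Big|\frac{\mathrm da}{\mathrm dx}\Big|<ab\quad\text{everywhere on }\mathbb R/\mathbb Z,$$ then $$\inf_{\gamma\in\Lambda^+(g,b)}\ell_{(g,b)}(\gamma)\le\frac{\pi}{\langle b\rangle}.$$ Equality holds if and only if $(g,b)$ is Zoll.
   Context: A magnetic system on a closed oriented surface $\Sigma$ is a pair $(g,b)$ with $g$ a Riemannian metric and $b:\Sigma\to\mathbb R$ smooth. A $(g,b)$-geodesic is a unit-speed curve $\gamma:\mathbb R\to\Sigma$ with geodesic curvature $\kappa_\gamma(t)=b(\gamma(t))$, i.e. $\nabla_{\dot\gamma}\dot\gamma=b(\gamma)\,\dot\gamma^\perp$, where $\dot\gamma^\perp$ is $\dot\gamma$ rotated by $+\pi/2$. The flow $\Phi^t_{g,b}$ on the unit tangent bundle $\mathrm S\Sigma$ sends $(q,v)$ to $(\gamma(t),\dot\gamma(t))$, where $\gamma$ is the $(g,b)$-geodesic with $(\gamma(0),\dot\gamma(0))=(q,v)$. The torus $\mathbb T^2$ is oriented by $\mathrm dx\wedge\mathrm dy$. The average of $b$ is $\langle b\rangle=\frac{1}{\mathrm{area}(\Sigma,g)}\int_\Sigma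 b\,\mu_g$, with $\mu_g$ the area form of $g$. $(g,b)$ is Zoll if $\Phi^t_{g,b}$ yields (up to time reparametrization of the orbits) a free $S^1$-action on $\mathrm S\Sigma$, i.e. the oriented flow orbits are exactly the oriented orbits of a smooth free $S^1$-action on $\mathrm S\Sigma$. $\Lambda^+(\Sigma)$ is the class of closed curves $\gamma$ on $\Sigma$ whose lift $(\gamma,\dot\gamma)$ to $\mathrm S\Sigma$ is (freely) homotopic to an oriented fiber of $\pi:\mathrm S\Sigma\to\Sigma$; for $\Sigma=\mathbb T^2$ these are the contractible closed curves with turning number $+1$. $\Lambda^+(g,b)$ is the set of closed $(g,b)$-geodesics in $\Lambda^+(\Sigma)$. For $\gamma\in\Lambda^+(\Sigma)$, $$\ell_{(g,b)}(\gamma):=\ell_g(\gamma)-\int_{D^2}\Gamma^*(b\mu_g),$$ where $\ell_g$ is the $g$-length and $\Gamma:D^2\to\Sigma$ is a capping disc for $\gamma$ obtained by projecting to $\Sigma$ a homotopy between $(\gamma,\dot\gamma)$ and a $\pi$-fiber (on $\mathbb T^2$ any capping disc gives the same value). *)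

theory Defs
  imports "HOL-Analysis.Analysis"
begin

section \<open>Smooth maps between subsets of Euclidean spaces\<close>

text \<open>\<^term>\<open>C_k_on k U f\<close> is meant for open \<^term>\<open>U\<close>.\<close>

primrec C_k_on :: "nat \<Rightarrow> 'a::euclidean_space set \<Rightarrow> ('a \<Rightarrow> 'b::euclidean_space) \<Rightarrow> bool" where
  "C_k_on 0 U f \<longleftrightarrow> continuous_on U f"
| "C_k_on (Suc k) U f \<longleftrightarrow>
     f differentiable_on U \<and> (\<forall>v. C_k_on k U (\<lambda>x. frechet_derivative f (at x) v))"

text \<open>On an arbitrary subset (in particular on an embedded submanifold), a map is smooth if it is
  locally the restriction of a smooth map defined on an open set.\<close>

definition smooth_on :: "'a::euclidean_space set \<Rightarrow> ('a \<Rightarrow> 'b::euclidean_space) \<Rightarrow> bool" where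
  "smooth_on S f \<longleftrightarrow>
     (\<forall>x\<in>S. \<exists>U h. open U \<and> x \<in> U \<and> (\<forall>k. C_k_on k U h) \<and> (\<forall>y\<in>S \<inter> U. h y = f y))"


section \<open>Riemannian metrics on the plane and their geodesic curvature\<close>

text \<open>Points and tangent vectors of the torus \<open>\<real>\<^sup>2 / (\<int> \<times> L\<int>)\<close> are described on its universal cover
  \<open>\<real>\<^sup>2\<close>, oriented by \<open>dx \<and> dy\<close>.  A metric \<open>g\<close> assigns to a point \<open>p\<close> the inner product
  \<open>g p\<close> on tangent vectors; metrics and functions on the torus are those that are
  invariant under translations by \<open>\<int> \<times> L\<int>\<close>.  A curve in the torus is given by one of its lifts.\<close>

type_synonym plane = "real \<times> real"
type_synonym metric = "plane \<Rightarrow> plane \<Rightarrow> plane \<Rightarrow> real"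

abbreviation velocity :: "(real \<Rightarrow> plane) \<Rightarrow> real \<Rightarrow> plane" where
  "velocity \<gamma> t \<equiv> vector_derivative \<gamma> (at t)"

definition metric_deriv :: "metric \<Rightarrow> plane \<Rightarrow> plane \<Rightarrow> plane \<Rightarrow> plane \<Rightarrow> real" where
  "metric_deriv g p w u v = frechet_derivative (\<lambda>q. g q u v) (at p) w"

text \<open>The Levi-Civita derivative of the constant vector field \<open>v\<close> in direction \<open>u\<close>, i.e. the vector
  with components \<open>\<Gamma>\<^sup>k\<^sub>i\<^sub>j u\<^sup>i v\<^sup>j\<close>, determined by the Koszul formula for constant (hence commuting)
  vector fields.\<close>

definition christoffel :: "metric \<Rightarrow> plane \<Rightarrow> plane \<Rightarrow> plane \<Rightarrow> plane" where
  "christoffel g p u v = (THE z. \<forall>w.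
     2 * g p z w = metric_deriv g p u v w + metric_deriv g p v u w - metric_deriv g p w u v)"

text \<open>\<open>\<nabla>\<close> of the velocity along the curve.\<close>

definition covariant_acceleration :: "metric \<Rightarrow> (real \<Rightarrow> plane) \<Rightarrow> real \<Rightarrow> plane" where
  "covariant_acceleration g \<gamma> t =
     vector_derivative (velocity \<gamma>) (at t) + christoffel g (\<gamma> t) (velocity \<gamma> t) (velocity \<gamma> t)"

text \<open>Rotation by \<open>+\<pi>/2\<close>.\<close>

definition perp :: "metric \<Rightarrow> plane \<Rightarrow> plane \<Rightarrow> plane" where
  "perp g p v = (THE w. g p v w = 0 \<and> g p w w = g p v v \<and> fst v * snd w - snd v * fst w \<ge> 0)"

definition area_form :: "metric \<Rightarrow> plane \<Rightarrow> plane \<Rightarrow> plane \<Rightarrow> real" where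
  "area_form g p u v =
     sqrt (g p (1,0) (1,0) * g p (0,1) (0,1) - (g p (1,0) (0,1))\<^sup>2) * (fst u * snd v - snd u * fst v)"

definition magnetic_geodesic :: "metric \<Rightarrow> (plane \<Rightarrow> real) \<Rightarrow> (real \<Rightarrow> plane) \<Rightarrow> bool" where
  "magnetic_geodesic g b \<gamma> \<longleftrightarrow>
     (\<forall>t. \<gamma> differentiable at t \<and> velocity \<gamma> differentiable at t \<and>
          g (\<gamma> t) (velocity \<gamma> t) (velocity \<gamma> t) = 1 \<and>
          covariant_acceleration g \<gamma> t = b (\<gamma> t) *\<^sub>R perp g (\<gamma> t) (velocity \<gamma> t))"

definition magnetic_flow :: "metric \<Rightarrow> (plane \<Rightarrow> real) \<Rightarrow> real \<Rightarrow> plane \<times> plane \<Rightarrow> plane \<times> plane" where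
  "magnetic_flow g b t = (\<lambda>(q, v).
     let \<gamma> = (THE \<gamma>. magnetic_geodesic g b \<gamma> \<and> \<gamma> 0 = q \<and> velocity \<gamma> 0 = v)
     in (\<gamma> t, velocity \<gamma> t))"


section \<open>The torus and its unit tangent bundle\<close>

text \<open>The torus is realised as the product of two unit circles, and \<open>torus_proj L\<close> is the
  quotient map by \<open>\<int> \<times> L\<int>\<close>.  Translations act trivially on the components of tangent vectors,
  so the unit tangent bundle is an embedded submanifold of \<open>\<complex>\<^sup>2 \<times> \<real>\<^sup>2\<close>.\<close>

definition torus_proj :: "real \<Rightarrow> plane \<Rightarrow> complex \<times> complex" where
  "torus_proj L p = (cis (2 * pi * fst p), cis (2 * pi * snd p / L))"

type_synonym bundle_point = "(complex \<times> complex) \<times> plane"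

definition bundle_proj :: "real \<Rightarrow> plane \<times> plane \<Rightarrow> bundle_point" where
  "bundle_proj L = (\<lambda>(p, v). (torus_proj L p, v))"

definition unit_bundle :: "real \<Rightarrow> metric \<Rightarrow> bundle_point set" where
  "unit_bundle L g = bundle_proj L ` {(p, v). g p v v = 1}"

definition average :: "real \<Rightarrow> metric \<Rightarrow> (plane \<Rightarrow> real) \<Rightarrow> real" where
  "average L g b =
     integral (cbox (0,0) (1,L)) (\<lambda>p. b p * area_form g p (1,0) (0,1)) /
     integral (cbox (0,0) (1,L)) (\<lambda>p. area_form g p (1,0) (0,1))"


section \<open>Closed geodesics and their magnetic length\<close>

text \<open>A closed curve is a pair \<open>(\<gamma>, T)\<close> of a curve and a period of its projection to the torus.
  The lift of a closed curve to the unit tangent bundle and the oriented fibres are parametrised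
  over \<open>[0,1]\<close>; membership in \<open>Lambda_plus\<close> forces \<open>\<gamma>\<close> to have unit speed.\<close>

definition fibre_loop :: "real \<Rightarrow> metric \<Rightarrow> plane \<Rightarrow> plane \<Rightarrow> real \<Rightarrow> bundle_point" where
  "fibre_loop L g q v s =
     bundle_proj L (q, cos (2 * pi * s) *\<^sub>R v + sin (2 * pi * s) *\<^sub>R perp g q v)"

definition Lambda_plus :: "real \<Rightarrow> metric \<Rightarrow> ((real \<Rightarrow> plane) \<times> real) set" where
  "Lambda_plus L g = {(\<gamma>, T). smooth_on UNIV \<gamma> \<and> T > 0 \<and>
     (\<forall>t. torus_proj L (\<gamma> (t + T)) = torus_proj L (\<gamma> t)) \<and>
     (\<exists>q v. g q v v = 1 \<and>
        homotopic_loops (unit_bundle L g)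
          (\<lambda>s. bundle_proj L (\<gamma> (T * s), velocity \<gamma> (T * s))) (fibre_loop L g q v))}"

definition Lambda_plus_geodesics ::
    "real \<Rightarrow> metric \<Rightarrow> (plane \<Rightarrow> real) \<Rightarrow> ((real \<Rightarrow> plane) \<times> real) set" where
  "Lambda_plus_geodesics L g b = {(\<gamma>, T) \<in> Lambda_plus L g. magnetic_geodesic g b \<gamma>}"

text \<open>A capping disc, written in polar coordinates as a homotopy \<open>\<Gamma> (s, t)\<close> from a constant map
  (\<open>s = 0\<close>) to the given closed curve (\<open>s = 1\<close>).  Discs are simply connected, so they lift to the
  plane.  The value of the integral of the pulled back 2-form does not depend on the disc.\<close>

definition capping_disc :: "(real \<Rightarrow> plane) \<Rightarrow> real \<Rightarrow> (real \<times> real \<Rightarrow> plane) \<Rightarrow> bool" where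
  "capping_disc \<gamma> T \<Gamma> \<longleftrightarrow> smooth_on UNIV \<Gamma> \<and>
     (\<forall>s\<in>{0..1}. \<forall>t. \<Gamma> (s, t + T) = \<Gamma> (s, t)) \<and>
     (\<forall>t. \<Gamma> (0, t) = \<Gamma> (0, 0)) \<and> (\<forall>t. \<Gamma> (1, t) = \<gamma> t)"

definition disc_integral ::
    "metric \<Rightarrow> (plane \<Rightarrow> real) \<Rightarrow> real \<Rightarrow> (real \<times> real \<Rightarrow> plane) \<Rightarrow> real" where
  "disc_integral g b T \<Gamma> = integral (cbox (0,0) (1,T)) (\<lambda>p. b (\<Gamma> p) * area_form g (\<Gamma> p)
     (frechet_derivative \<Gamma> (at p) (1,0)) (frechet_derivative \<Gamma> (at p) (0,1)))"

definition curve_length :: "metric \<Rightarrow> (real \<Rightarrow> plane) \<times> real \<Rightarrow> real" where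
  "curve_length g = (\<lambda>(\<gamma>, T). integral {0..T} (\<lambda>t. sqrt (g (\<gamma> t) (velocity \<gamma> t) (velocity \<gamma> t))))"

definition magnetic_length :: "metric \<Rightarrow> (plane \<Rightarrow> real) \<Rightarrow> (real \<Rightarrow> plane) \<times> real \<Rightarrow> real" where
  "magnetic_length g b = (\<lambda>(\<gamma>, T).
     curve_length g (\<gamma>, T) - disc_integral g b T (SOME \<Gamma>. capping_disc \<gamma> T \<Gamma>))"


section \<open>Zoll systems\<close>

definition smooth_free_circle_action ::
    "'a::euclidean_space set \<Rightarrow> (complex \<Rightarrow> 'a \<Rightarrow> 'a) \<Rightarrow> bool" where
  "smooth_free_circle_action M \<rho> \<longleftrightarrow>
     (\<forall>z\<in>sphere 0 1. \<forall>m\<in>M. \<rho> z m \<in> M) \<and>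
     (\<forall>m\<in>M. \<rho> 1 m = m) \<and>
     (\<forall>z\<in>sphere 0 1. \<forall>w\<in>sphere 0 1. \<forall>m\<in>M. \<rho> (z * w) m = \<rho> z (\<rho> w m)) \<and>
     (\<forall>z\<in>sphere 0 1. \<forall>m\<in>M. \<rho> z m = m \<longrightarrow> z = 1) \<and>
     smooth_on (sphere 0 1 \<times> M) (\<lambda>(z, m). \<rho> z m)"

text \<open>The oriented flow orbit of each point agrees with its oriented orbit under the action: they
  differ by an increasing bijection \<open>\<tau>\<close> of the time axis.\<close>

definition zoll :: "real \<Rightarrow> metric \<Rightarrow> (plane \<Rightarrow> real) \<Rightarrow> bool" where
  "zoll L g b \<longleftrightarrow>
     (\<exists>\<rho>. smooth_free_circle_action (unit_bundle L g) \<rho> \<and>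
       (\<forall>q v. g q v v = 1 \<longrightarrow>
         (\<exists>\<tau>::real \<Rightarrow> real. strict_mono \<tau> \<and> surj \<tau> \<and>
           (\<forall>t. bundle_proj L (magnetic_flow g b t (q, v)) = \<rho> (cis (\<tau> t)) (bundle_proj L (q, v))))))"


section \<open>Rotationally symmetric metrics\<close>

text \<open>\<open>dx\<^sup>2 + a(x)\<^sup>2 dy\<^sup>2\<close>\<close>

definition rot_metric :: "(real \<Rightarrow> real) \<Rightarrow> metric" where
  "rot_metric a p u v = fst u * fst v + (a (fst p))\<^sup>2 * (snd u * snd v)"

end

theory Submission
  imports Defs "HOL-Complex_Analysis.Complex_Analysis"
begin

text \<open>Let \<open>\<theta>\<close> be the angle of the velocity, \<open>\<gamma>' = (cos \<theta>, sin \<theta> / a)\<close>. The hypothesis says that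
  \<open>\<theta>' = b - (a'/a) sin \<theta> > 0\<close>, so \<open>\<theta>\<close> parametrises every geodesic, and \<open>I = F(x) - a(x) sin \<theta>\<close> with
  \<open>F' = a b\<close> is a first integral. Since \<open>F(x) - a(x) sin \<theta>\<close> is strictly increasing in \<open>x\<close>, it can be
  solved for \<open>x = X(I, \<theta>)\<close>. Put \<open>J(I) = \<integral>\<^sub>0\<^bsup>2\<pi>\<^esup> X(I, \<theta>) sin \<theta> d\<theta>\<close>, a function of period \<open>A = F(1)\<close>. Its
  derivative is the displacement of \<open>y\<close> after one turn of \<open>\<theta>\<close>, so that the geodesics in the class of
  the fibres correspond to the critical points of \<open>J\<close>; by Stokes' theorem their magnetic length is
  \<open>J(I)\<close>. Substituting \<open>x = X(I, \<theta>)\<close> shows that the mean of \<open>J\<close> over a period is \<open>\<pi> / \<langle>b\<rangle>\<close>. Hence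
  \<open>min J \<le> \<pi> / \<langle>b\<rangle>\<close>, with equality iff \<open>J\<close> is constant. In that case all geodesics close up after
  one turn, and rotating \<open>\<theta>\<close> is a free circle action. Conversely, if the system is Zoll, a multiple
  of each displacement lies in \<open>L\<int>\<close>; being continuous, the displacement is then constant, and it
  vanishes because \<open>J\<close> is periodic.\<close>

section \<open>Calculus of \<open>C\<^sup>k\<close> maps\<close>

text \<open>One positive function carries the argument: \<open>W\<close> is both the
  \<open>x\<close>-derivative of the first integral and \<open>a\<close> times the angular speed.
  Hence the single pointwise hypothesis makes the angle a global clock and also makes
  \<open>x\<close> a smooth function of level and angle. As \<open>X\<close> has
  \<open>I\<close>-derivative \<open>1 / W\<close>, the derivative of \<open>J\<close> is the
  integral of \<open>sin \<theta> / W\<close>, which is dy/d\<theta>; this explains the weight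
  \<open>sin\<close> in \<open>J\<close>. Position and elapsed time along a geodesic are
  antiderivatives in the angle, so existence, uniqueness and completeness of the flow reduce to
  inverting one increasing function. The class of the fibres is given only by a free homotopy in the
  unit tangent bundle. Three winding numbers recover from it that the lifted curve closes up in the
  plane after exactly one turn, which excludes multiple coverings and non-contractible orbits.
  Smoothness of the circle action concerns a subset of a Euclidean space, so the action has to be
  extended locally to open sets of the ambient space; local branches of the angle serve this
  purpose.\<close>

lemma C_k_on_cong:
  assumes "open U" "\<And>x. x \<in> U \<Longrightarrow> f x = g x" "C_k_on k U f"
  shows "C_k_on k U g"
  using assms(2,3)
proof (induction k arbitrary: f g)
  case 0
  then show ?case
    by (metis C_k_on.simps(1) continuous_on_cong)
next
  case (Suc k)
  have d: "(g has_derivative frechet_derivative f (at x)) (at x)" if "x \<in> U" for x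
  proof -
    have "f differentiable at x"
      using Suc.prems(2) that \<open>open U\<close> by (auto simp: differentiable_on_def at_within_open_NO_MATCH)
    hence "(f has_derivative frechet_derivative f (at x)) (at x)"
      by (simp add: frechet_derivative_works)
    thus ?thesis
      by (rule has_derivative_transform_within_open[OF _ \<open>open U\<close> that]) (rule Suc.prems(1))
  qed
  have eq: "frechet_derivative g (at x) = frechet_derivative f (at x)" if "x \<in> U" for x
    using frechet_derivative_at[OF d[OF that]] by simp
  have "g differentiable_on U"
    using d unfolding differentiable_on_def differentiable_def
    by (meson has_derivative_at_withinI)
  moreover have "C_k_on k U (\<lambda>x. frechet_derivative g (at x) v)" for v
  proof (rule Suc.IH[of "\<lambda>x. frechet_derivative f (at x) v"])
    show "frechet_derivative f (at x) v = frechet_derivative g (at x) v" if "x \<in> U" for x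
      by (simp only: eq[OF that])
    show "C_k_on k U (\<lambda>x. frechet_derivative f (at x) v)"
      using Suc.prems(2) by simp
  qed
  ultimately show ?case by simp
qed

lemma C_k_on_SucI:
  assumes "open U" "\<And>x. x \<in> U \<Longrightarrow> (f has_derivative f' x) (at x)"
    and "\<And>v. C_k_on k U (\<lambda>x. f' x v)"
  shows "C_k_on (Suc k) U f"
proof -
  have "f differentiable_on U"
    using assms(2) unfolding differentiable_on_def differentiable_def
    by (meson has_derivative_at_withinI)
  moreover have "C_k_on k U (\<lambda>x. frechet_derivative f (at x) v)" for v
  proof (rule C_k_on_cong[OF \<open>open U\<close> _ assms(3)[of v]])
    show "f' x v = frechet_derivative f (at x) v" if "x \<in> U" for x
      by (simp only: frechet_derivative_at[OF assms(2)[OF that]])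
  qed
  ultimately show ?thesis by simp
qed

lemma C_k_on_SucD:
  assumes "open U" "C_k_on (Suc k) U f" "x \<in> U"
  shows "(f has_derivative frechet_derivative f (at x)) (at x)"
proof -
  have "f differentiable at x"
    using assms by (auto simp: differentiable_on_def at_within_open_NO_MATCH)
  thus ?thesis by (simp add: frechet_derivative_works)
qed

lemma C_k_on_Suc_imp: "C_k_on (Suc k) U f \<Longrightarrow> C_k_on k U f"
proof (induction k arbitrary: f)
  case 0
  then show ?case by (simp add: differentiable_imp_continuous_on)
next
  case (Suc k)
  then show ?case by (metis C_k_on.simps(2))
qed

lemma C_k_on_imp_continuous_on: "C_k_on k U f \<Longrightarrow> continuous_on U f"
  by (induction k) (auto dest: C_k_on_Suc_imp simp del: C_k_on.simps(2))

lemma C_k_on_subset: "C_k_on k U f \<Longrightarrow> open U \<Longrightarrow> open V \<Longrightarrow> V \<subseteq> U \<Longrightarrow> C_k_on k V f"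
  by (induction k arbitrary: f) (auto intro: continuous_on_subset differentiable_on_subset)

lemma C_k_on_local:
  assumes "open S" "\<And>x. x \<in> S \<Longrightarrow> \<exists>U. open U \<and> x \<in> U \<and> C_k_on k U f"
  shows "C_k_on k S f"
  using assms(2)
proof (induction k arbitrary: f)
  case 0
  then show ?case
    by (auto simp: continuous_on_eq_continuous_at assms(1)) (metis continuous_on_eq_continuous_at)
next
  case (Suc k)
  have "f differentiable_on S"
    unfolding differentiable_on_def
  proof
    fix x assume "x \<in> S"
    then obtain U where "open U" "x \<in> U" "C_k_on (Suc k) U f"
      using Suc.prems by blast
    thus "f differentiable at x within S"
      by (metis C_k_on_SucD differentiable_def has_derivative_at_withinI)
  qed
  moreover have "C_k_on k S (\<lambda>x. frechet_derivative f (at x) v)" for v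
    by (rule Suc.IH) (use Suc.prems in auto)
  ultimately show ?case by simp
qed

lemma C_k_on_const: "C_k_on k U (\<lambda>x. c)"
  by (induction k arbitrary: c) auto

lemma C_k_on_bounded_linear:
  assumes "open U" "bounded_linear f"
  shows "C_k_on k U f"
proof (cases k)
  case 0
  then show ?thesis using assms linear_continuous_on by auto
next
  case (Suc j)
  show ?thesis unfolding Suc
    by (rule C_k_on_SucI[OF assms(1), of _ "\<lambda>_. f"])
      (use bounded_linear.has_derivative[OF assms(2) has_derivative_ident] C_k_on_const in auto)
qed

lemma C_k_on_linear_comp:
  assumes "open U" "bounded_linear L" "C_k_on k U f"
  shows "C_k_on k U (\<lambda>x. L (f x))"
  using assms(3)
proof (induction k arbitrary: f)
  case 0
  then show ?case using assms(2)
    by (simp add: bounded_linear.continuous_on)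
next
  case (Suc k)
  show ?case
  proof (rule C_k_on_SucI[OF assms(1)])
    show "((\<lambda>x. L (f x)) has_derivative (\<lambda>v. L (frechet_derivative f (at x) v))) (at x)" if "x \<in> U" for x
      by (rule bounded_linear.has_derivative[OF assms(2) C_k_on_SucD[OF assms(1) Suc.prems that]])
    show "C_k_on k U (\<lambda>x. L (frechet_derivative f (at x) v))" for v
      by (rule Suc.IH) (use Suc.prems in auto)
  qed
qed

lemma C_k_on_add:
  assumes "open U" "C_k_on k U f" "C_k_on k U g"
  shows "C_k_on k U (\<lambda>x. f x + g x)"
  using assms(2,3)
proof (induction k arbitrary: f g)
  case 0
  then show ?case by (simp add: continuous_on_add)
next
  case (Suc k)
  show ?case
  proof (rule C_k_on_SucI[OF assms(1)])
    show "((\<lambda>x. f x + g x) has_derivative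
       (\<lambda>v. frechet_derivative f (at x) v + frechet_derivative g (at x) v)) (at x)" if "x \<in> U" for x
      by (intro has_derivative_add C_k_on_SucD[OF assms(1) Suc.prems(1) that] C_k_on_SucD[OF assms(1) Suc.prems(2) that])
    show "C_k_on k U (\<lambda>x. frechet_derivative f (at x) v + frechet_derivative g (at x) v)" for v
      by (rule Suc.IH) (use Suc.prems in auto)
  qed
qed

lemma C_k_on_minus:
  assumes "open U" "C_k_on k U f"
  shows "C_k_on k U (\<lambda>x. - f x)"
  by (rule C_k_on_linear_comp[OF assms(1) _ assms(2)]) (rule bounded_linear_minus[OF bounded_linear_ident])

lemma C_k_on_diff:
  assumes "open U" "C_k_on k U f" "C_k_on k U g"
  shows "C_k_on k U (\<lambda>x. f x - g x)"
  using C_k_on_add[OF assms(1,2) C_k_on_minus[OF assms(1,3)]] by simp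

lemma C_k_on_sum:
  assumes "open U" "\<And>i. i \<in> A \<Longrightarrow> C_k_on k U (f i)"
  shows "C_k_on k U (\<lambda>x. \<Sum>i\<in>A. f i x)"
  using assms(2)
  by (induction A rule: infinite_finite_induct) (auto intro: C_k_on_const C_k_on_add[OF assms(1)])

lemma C_k_on_bilinear:
  assumes "bounded_bilinear pr" "open U" "C_k_on k U f" "C_k_on k U g"
  shows "C_k_on k U (\<lambda>x. pr (f x) (g x))"
  using assms(3,4)
proof (induction k arbitrary: f g)
  case 0
  then show ?case by (simp add: bounded_bilinear.continuous_on[OF assms(1)])
next
  case (Suc k)
  show ?case
  proof (rule C_k_on_SucI[OF assms(2)])
    show "((\<lambda>x. pr (f x) (g x)) has_derivative
       (\<lambda>v. pr (f x) (frechet_derivative g (at x) v) + pr (frechet_derivative f (at x) v) (g x))) (at x)"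
      if "x \<in> U" for x
      by (rule bounded_bilinear.FDERIV[OF assms(1) C_k_on_SucD[OF assms(2) Suc.prems(1) that]
          C_k_on_SucD[OF assms(2) Suc.prems(2) that]])
    show "C_k_on k U (\<lambda>x. pr (f x) (frechet_derivative g (at x) v) + pr (frechet_derivative f (at x) v) (g x))" for v
      using Suc.prems C_k_on_Suc_imp[OF Suc.prems(1)] C_k_on_Suc_imp[OF Suc.prems(2)]
      by (intro C_k_on_add[OF assms(2)] Suc.IH) (simp_all del: C_k_on.simps add: C_k_on.simps(2)[of k U])
  qed
qed

lemmas C_k_on_mult = C_k_on_bilinear[OF bounded_bilinear_mult]
lemmas C_k_on_scaleR = C_k_on_bilinear[OF bounded_bilinear_scaleR]

text \<open>\<open>C_k_on\<close> controls derivatives in fixed directions only, whereas the chain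
  rule evaluates the derivative of \<open>g\<close> in the moving direction
  \<open>frechet_derivative f (at x) v\<close>. Expanding this direction in the basis gives finitely
  many products of functions covered by the induction, with \<open>f\<close> fixed and
  \<open>g\<close> varying.\<close>

lemma C_k_on_compose:
  assumes "open U" "open V" "C_k_on k V g" "C_k_on k U f" "f ` U \<subseteq> V"
  shows "C_k_on k U (\<lambda>x. g (f x))"
  using assms(3,4)
proof (induction k arbitrary: g)
  case 0
  then show ?case using assms(5) continuous_on_compose2 by auto
next
  case (Suc k)
  show ?case
  proof (rule C_k_on_SucI[OF assms(1)])
    fix x assume x: "x \<in> U"
    have fx: "f x \<in> V" using x assms(5) by auto
    have lin: "linear (frechet_derivative g (at (f x)))"
      by (rule has_derivative_linear[OF C_k_on_SucD[OF assms(2) Suc.prems(1) fx]])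
    have "((\<lambda>x. g (f x)) has_derivative
        (\<lambda>v. frechet_derivative g (at (f x)) (frechet_derivative f (at x) v))) (at x)"
      by (rule has_derivative_compose[OF C_k_on_SucD[OF assms(1) Suc.prems(2) x]
            C_k_on_SucD[OF assms(2) Suc.prems(1) fx]])
    moreover have "frechet_derivative g (at (f x)) w =
        (\<Sum>i\<in>Basis. (w \<bullet> i) *\<^sub>R frechet_derivative g (at (f x)) i)" for w
      using arg_cong[OF euclidean_representation[of w], of "frechet_derivative g (at (f x))"]
      by (simp add: linear_sum[OF lin] linear_scale[OF lin])
    ultimately show "((\<lambda>x. g (f x)) has_derivative (\<lambda>v. \<Sum>i\<in>Basis. (frechet_derivative f (at x) v \<bullet> i) *\<^sub>R
        frechet_derivative g (at (f x)) i)) (at x)"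
      by (metis (no_types, lifting) ext)
  next
    fix v
    show "C_k_on k U (\<lambda>x. \<Sum>i\<in>Basis. (frechet_derivative f (at x) v \<bullet> i) *\<^sub>R
        frechet_derivative g (at (f x)) i)"
      by (intro C_k_on_sum C_k_on_scaleR assms(1)
          C_k_on_linear_comp[OF assms(1) bounded_linear_inner_left] Suc.IH)
        (use Suc.prems C_k_on_Suc_imp[OF Suc.prems(2)] in auto)
  qed
qed

lemma C_k_on_comp_UNIV:
  assumes "open U" "C_k_on k UNIV g" "C_k_on k U f"
  shows "C_k_on k U (\<lambda>x. g (f x))"
  using C_k_on_compose[OF assms(1) open_UNIV assms(2,3)] by simp

lemma C_k_on_Pair:
  assumes "open U" "C_k_on k U f" "C_k_on k U g"
  shows "C_k_on k U (\<lambda>x. (f x, g x))"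
proof -
  have 1: "C_k_on k U (\<lambda>x. (f x, 0))"
    by (rule C_k_on_linear_comp[OF assms(1) _ assms(2)])
      (intro bounded_linear_Pair bounded_linear_ident bounded_linear_zero)
  have 2: "C_k_on k U (\<lambda>x. (0, g x))"
    by (rule C_k_on_linear_comp[OF assms(1) _ assms(3)])
      (intro bounded_linear_Pair bounded_linear_ident bounded_linear_zero)
  show ?thesis using C_k_on_add[OF assms(1) 1 2] by simp
qed

lemma C_k_on_fst: "open U \<Longrightarrow> C_k_on k U f \<Longrightarrow> C_k_on k U (\<lambda>x. fst (f x))"
  by (rule C_k_on_linear_comp[OF _ bounded_linear_fst])

lemma C_k_on_snd: "open U \<Longrightarrow> C_k_on k U f \<Longrightarrow> C_k_on k U (\<lambda>x. snd (f x))"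
  by (rule C_k_on_linear_comp[OF _ bounded_linear_snd])

lemma C_k_on_Suc_real:
  fixes f :: "real \<Rightarrow> 'b::euclidean_space"
  assumes "open U" "\<And>x. x \<in> U \<Longrightarrow> (f has_vector_derivative f' x) (at x)" "C_k_on k U f'"
  shows "C_k_on (Suc k) U f"
  by (rule C_k_on_SucI[OF assms(1), of _ "\<lambda>x v. v *\<^sub>R f' x"])
    (use assms in \<open>auto simp: has_vector_derivative_def intro: C_k_on_scaleR C_k_on_const\<close>)

lemma C_k_on_inverse_real: "open U \<Longrightarrow> (0::real) \<notin> U \<Longrightarrow> C_k_on k U inverse"
proof (induction k)
  case 0
  then show ?case by (auto intro!: continuous_intros)
next
  case (Suc k)
  show ?case
  proof (rule C_k_on_Suc_real[OF Suc.prems(1)])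
    show "(inverse has_vector_derivative (- (inverse x * inverse x))) (at x)" if "x \<in> U" for x
      using that Suc.prems DERIV_inverse[of x UNIV]
      by (auto simp: has_real_derivative_iff_has_vector_derivative[symmetric] power2_eq_square numeral_2_eq_2)
    show "C_k_on k U (\<lambda>x. - (inverse x * inverse x))"
      by (intro C_k_on_minus C_k_on_mult Suc.IH Suc.prems)
  qed
qed

lemma C_k_on_divide:
  fixes f g :: "'a::euclidean_space \<Rightarrow> real"
  assumes "open U" "C_k_on k U f" "C_k_on k U g" "\<And>x. x \<in> U \<Longrightarrow> g x \<noteq> 0"
  shows "C_k_on k U (\<lambda>x. f x / g x)"
proof -
  have "C_k_on k U (\<lambda>x. inverse (g x))"
    by (rule C_k_on_compose[OF assms(1) _ C_k_on_inverse_real assms(3), of "-{0}"]) (use assms(4) in auto)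
  from C_k_on_mult[OF assms(1,2) this] show ?thesis by (simp add: divide_inverse)
qed

lemma C_k_on_sin_cos: "C_k_on k UNIV (sin::real\<Rightarrow>real) \<and> C_k_on k UNIV (cos::real\<Rightarrow>real)"
proof (induction k)
  case 0
  then show ?case by (auto intro!: continuous_intros)
next
  case (Suc k)
  have "C_k_on (Suc k) UNIV (sin::real\<Rightarrow>real)"
    by (rule C_k_on_Suc_real[of _ _ cos])
      (use Suc in \<open>auto simp: has_real_derivative_iff_has_vector_derivative[symmetric]\<close>)
  moreover have "C_k_on (Suc k) UNIV (cos::real\<Rightarrow>real)"
    by (rule C_k_on_Suc_real[of _ _ "\<lambda>x. - sin x"])
      (use Suc in \<open>auto simp: has_real_derivative_iff_has_vector_derivative[symmetric] intro!: C_k_on_minus DERIV_cos\<close>)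
  ultimately show ?case by blast
qed

lemmas C_k_on_sin = C_k_on_comp_UNIV[OF _ C_k_on_sin_cos[THEN conjunct1]]
lemmas C_k_on_cos = C_k_on_comp_UNIV[OF _ C_k_on_sin_cos[THEN conjunct2]]

lemma C_k_on_arctan: "C_k_on k UNIV arctan"
proof (cases k)
  case 0
  then show ?thesis by (auto intro!: continuous_intros)
next
  case (Suc j)
  show ?thesis unfolding Suc
  proof (rule C_k_on_Suc_real)
    show "(arctan has_vector_derivative (1 / (1 + x * x))) (at x)" for x
      using DERIV_arctan[of x]
      by (auto simp: has_real_derivative_iff_has_vector_derivative[symmetric] power2_eq_square inverse_eq_divide)
    have "1 + x * x \<noteq> 0" for x :: real using zero_le_square[of x] by linarith
    thus "C_k_on j UNIV (\<lambda>x::real. 1 / (1 + x * x))"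
      by (intro C_k_on_divide C_k_on_add C_k_on_const C_k_on_mult C_k_on_bounded_linear bounded_linear_ident) auto
  qed auto
qed

text \<open>The local extensions demanded by \<open>smooth_on\<close> agree with \<open>f\<close>
  itself near every point, and \<open>C_k_on\<close> is a local property; so they patch
  together.\<close>

lemma smooth_on_UNIV_iff: "smooth_on UNIV f \<longleftrightarrow> (\<forall>k. C_k_on k UNIV f)"
proof
  assume s: "smooth_on UNIV f"
  show "\<forall>k. C_k_on k UNIV f"
  proof
    fix k
    show "C_k_on k UNIV f"
    proof (rule C_k_on_local)
      fix x
      obtain U h where U: "open U" "x \<in> U" "\<forall>k. C_k_on k U h" "\<forall>y\<in>U. h y = f y"
        using s unfolding smooth_on_def by (metis UNIV_I Int_UNIV_left)
      thus "\<exists>U. open U \<and> x \<in> U \<and> C_k_on k U f"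
        using C_k_on_cong[OF U(1), of h f k] by blast
    qed auto
  qed
next
  assume "\<forall>k. C_k_on k UNIV f"
  thus "smooth_on UNIV f" unfolding smooth_on_def by (auto intro!: exI[of _ UNIV] exI[of _ f])
qed

lemma C_k_on_deriv:
  fixes f :: "real \<Rightarrow> real"
  assumes "\<forall>k. C_k_on k UNIV f"
  shows "(f has_real_derivative deriv f x) (at x)" "\<forall>k. C_k_on k UNIV (deriv f)"
proof -
  have d: "(f has_real_derivative frechet_derivative f (at y) 1) (at y)" for y
  proof -
    have 1: "(f has_derivative frechet_derivative f (at y)) (at y)"
      using C_k_on_SucD[of UNIV 0 f y] assms by (metis UNIV_I open_UNIV)
    have "frechet_derivative f (at y) = (*) (frechet_derivative f (at y) 1)"
    proof
      fix z
      show "frechet_derivative f (at y) z = frechet_derivative f (at y) 1 * z"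
        using linear_scale[OF has_derivative_linear[OF 1], of z 1] by (metis mult.commute mult.right_neutral real_scaleR_def)
    qed
    thus ?thesis using 1 by (simp add: has_field_derivative_def)
  qed
  have "deriv f y = frechet_derivative f (at y) 1" for y
    using d DERIV_imp_deriv by blast
  hence e: "deriv f = (\<lambda>y. frechet_derivative f (at y) 1)" by (rule ext)
  show "(f has_real_derivative deriv f x) (at x)" using d e by simp
  show "\<forall>k. C_k_on k UNIV (deriv f)"
    unfolding e using assms C_k_on.simps(2) by blast
qed

section \<open>Integrals depending on a parameter\<close>

text \<open>The Leibniz rule asks for a derivative that is continuous as an operator-valued map. In
  finite dimension this follows from continuity along each basis vector, which is what
  \<open>C_k_on 1\<close> provides. \<open>D p s\<close> is the derivative restricted to the
  parameter directions \<open>(v, 0)\<close>.\<close>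

lemma has_derivative_integral_param:
  fixes f :: "'a::euclidean_space \<times> real \<Rightarrow> real"
  assumes "C_k_on 1 UNIV f"
  shows "((\<lambda>p. integral {c..d} (\<lambda>s. f (p, s))) has_derivative
    (\<lambda>v. integral {c..d} (\<lambda>s. frechet_derivative f (at (p, s)) (v, 0)))) (at p)"
proof -
  note D = C_k_on_SucD[OF open_UNIV, of 0 f, unfolded One_nat_def[symmetric], OF assms UNIV_I]
  define D where "D p s = blinfun_compose (Blinfun (frechet_derivative f (at (p, s)))) (Blinfun (\<lambda>v. (v, 0)))" for p s
  have bl: "bounded_linear (\<lambda>v::'a. (v, 0::real))"
    by (intro bounded_linear_Pair bounded_linear_ident bounded_linear_zero)
  have app: "blinfun_apply (D p s) v = frechet_derivative f (at (p, s)) (v, 0)" for p s v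
    by (simp add: D_def bounded_linear_Blinfun_apply[OF has_derivative_bounded_linear[OF D]]
        bounded_linear_Blinfun_apply[OF bl])
  have cont1: "continuous_on UNIV (\<lambda>q. frechet_derivative f (at q) v)" for v
    using assms unfolding One_nat_def C_k_on.simps by blast
  have cont: "continuous_on UNIV (\<lambda>(p, s). D p s)"
  proof (rule continuous_on_blinfun_componentwise)
    fix i :: 'a assume "i \<in> Basis"
    show "continuous_on UNIV (\<lambda>x. blinfun_apply (case x of (p, s) \<Rightarrow> D p s) i)"
      using cont1[of "(i, 0)"] by (simp add: case_prod_unfold app)
  qed
  have int1: "(\<lambda>s. f (p, s)) integrable_on cbox c d" for p
    by (intro integrable_continuous continuous_on_compose2[OF C_k_on_imp_continuous_on[OF assms]]
        continuous_intros) auto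
  have cD: "continuous_on (cbox c d) (D p)" for p
  proof -
    have "continuous_on (cbox c d) (\<lambda>s. (p, s))" by (intro continuous_intros)
    from continuous_on_compose2[OF cont this] show ?thesis by simp
  qed
  have "((\<lambda>p. integral (cbox c d) (\<lambda>s. f (p, s))) has_derivative integral (cbox c d) (D p)) (at p within UNIV)"
  proof (rule leibniz_rule)
    fix q s assume "s \<in> cbox c d"
    have "((\<lambda>p. f (p, s)) has_derivative (\<lambda>v. frechet_derivative f (at (q, s)) (v, 0))) (at q)"
      by (rule has_derivative_compose[OF _ D])
        (auto intro!: derivative_eq_intros)
    thus "((\<lambda>p. f (p, s)) has_derivative D q s) (at q within UNIV)"
      by (simp add: app[abs_def])
  qed (auto intro: int1[unfolded cbox_interval] continuous_on_subset[OF cont])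
  moreover have "blinfun_apply (integral (cbox c d) (D p)) =
      (\<lambda>v. integral (cbox c d) (\<lambda>s. frechet_derivative f (at (p, s)) (v, 0)))"
    using blinfun_apply_integral[OF integrable_continuous[OF cD[of p]]] by (simp add: app fun_eq_iff)
  ultimately show ?thesis by simp
qed

text \<open>Each directional derivative of the integral is again an integral with a parameter, of
  the smooth function \<open>frechet_derivative f (at q) (v, 0)\<close>, so the induction runs over
  all smooth \<open>f\<close> at once.\<close>

lemma C_k_on_integral_param:
  fixes f :: "'a::euclidean_space \<times> real \<Rightarrow> real"
  assumes "\<forall>k. C_k_on k UNIV f"
  shows "C_k_on k UNIV (\<lambda>p. integral {c..d} (\<lambda>s. f (p, s)))"
  using assms
proof (induction k arbitrary: f)
  case 0
  note hd = has_derivative_integral_param[OF 0[rule_format, of 1], of c d]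
  show ?case
    unfolding C_k_on.simps continuous_on_eq_continuous_at[OF open_UNIV]
    using hd has_derivative_continuous by blast
next
  case (Suc k)
  show ?case
  proof (rule C_k_on_SucI)
    show "((\<lambda>p. integral {c..d} (\<lambda>s. f (p, s))) has_derivative
      (\<lambda>v. integral {c..d} (\<lambda>s. frechet_derivative f (at (p, s)) (v, 0)))) (at p)" for p
      by (rule has_derivative_integral_param[OF Suc.prems[rule_format, of 1]])
    show "C_k_on k UNIV (\<lambda>p. integral {c..d} (\<lambda>s. frechet_derivative f (at (p, s)) (v, 0)))" for v
      using Suc.IH[of "\<lambda>q. frechet_derivative f (at q) (v, 0)"] Suc.prems
      by (metis C_k_on.simps(2))
  qed auto
qed

section \<open>Antiderivatives on the whole line and quasi-periodic functions\<close>

definition prim :: "(real \<Rightarrow> real) \<Rightarrow> real \<Rightarrow> real" where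
  "prim f = (SOME F. (\<forall>x. (F has_real_derivative f x) (at x)) \<and> F 0 = 0)"

text \<open>The antiderivative is taken on the whole line because angles, positions and times of
  either sign occur; the integral over \<open>{0..x}\<close> would be 0 for negative
  \<open>x\<close>, the interval being empty.\<close>

lemma prim:
  assumes "continuous_on UNIV f"
  shows DERIV_prim: "(prim f has_real_derivative f x) (at x)" and prim_0: "prim f 0 = 0"
proof -
  have "\<exists>F. \<forall>x. - \<infinity> < ereal x \<longrightarrow> ereal x < \<infinity> \<longrightarrow> (F has_vector_derivative f x) (at x)"
    by (rule einterval_antiderivative) (use assms in \<open>auto simp: continuous_on_eq_continuous_at\<close>)
  then obtain F where F: "\<And>x. (F has_real_derivative f x) (at x)"
    by (auto simp: has_real_derivative_iff_has_vector_derivative)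
  have "\<exists>F. (\<forall>x. (F has_real_derivative f x) (at x)) \<and> F 0 = 0"
    by (rule exI[of _ "\<lambda>x. F x - F 0"]) (auto intro!: derivative_eq_intros F)
  from someI_ex[OF this, folded prim_def]
  show "(prim f has_real_derivative f x) (at x)" "prim f 0 = 0" by auto
qed

lemma prim_has_integral:
  assumes "continuous_on UNIV f" "c \<le> d"
  shows "(f has_integral prim f d - prim f c) {c..d}"
  by (rule fundamental_theorem_of_calculus[OF assms(2)])
    (use DERIV_prim[OF assms(1)] in
      \<open>auto simp: has_real_derivative_iff_has_vector_derivative intro: has_vector_derivative_at_within\<close>)

text \<open>Moves \<open>x\<close> from the limit of integration into the integrand, where it is one
  more parameter. This gives the joint smoothness of \<open>G\<close> in level and angle.\<close>

lemma prim_rescale: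
  assumes "continuous_on UNIV f"
  shows "prim f x = integral {0..1} (\<lambda>u. x * f (x * u))"
proof -
  have "((\<lambda>u. x * f (x * u)) has_integral prim f (x * 1) - prim f (x * 0)) {0..1}"
  proof (rule fundamental_theorem_of_calculus)
    fix u
    have "((\<lambda>u. prim f (x * u)) has_real_derivative f (x * u) * x) (at u)"
      by (rule DERIV_chain'[OF _ DERIV_prim[OF assms]]) (auto intro!: derivative_eq_intros)
    thus "((\<lambda>u. prim f (x * u)) has_vector_derivative x * f (x * u)) (at u within {0..1})"
      by (simp add: has_real_derivative_iff_has_vector_derivative mult.commute has_vector_derivative_at_within)
  qed auto
  thus ?thesis
    using prim_0[OF assms] by (simp only: mult_1_right mult_zero_right diff_zero integral_unique)
qed

lemma DERIV_eq_diff_const: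
  fixes f g :: "real \<Rightarrow> real"
  assumes "\<And>x. (f has_real_derivative h x) (at x)" "\<And>x. (g has_real_derivative h x) (at x)"
  shows "f x - f y = g x - g y"
proof -
  have "((\<lambda>x. f x - g x) has_real_derivative 0) (at x)" for x
    using DERIV_diff[OF assms, of x] by simp
  hence "f x - g x = f y - g y" by (metis DERIV_isconst_all)
  thus ?thesis by simp
qed

lemma prim_periodic:
  assumes "continuous_on UNIV f" "\<And>x. f (x + p) = f x"
  shows "prim f (x + p) = prim f x + prim f p"
proof -
  have "((\<lambda>x. prim f (x + p)) has_real_derivative f x) (at x)" for x
    using DERIV_prim[OF assms(1), of "x + p"] assms(2) by (simp add: DERIV_shift)
  from DERIV_eq_diff_const[OF this DERIV_prim[OF assms(1)], of x 0]
  show ?thesis by (simp add: prim_0[OF assms(1)])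
qed

text \<open>The values at \<open>n * p\<close> and \<open>- n * p\<close> are
  \<open>h 0 + n * c\<close> and \<open>h 0 - n * c\<close>, so the connected range is unbounded in
  both directions. Used for \<open>H\<close> in \<open>x\<close> and for the elapsed time in the
  angle.\<close>

lemma quasi_periodic_surj:
  fixes h :: "real \<Rightarrow> real"
  assumes "continuous_on UNIV h" "\<And>x. h (x + p) = h x + c" "c > 0"
  shows "\<exists>x. h x = y"
proof -
  have per: "h (x + real n * p) = h x + real n * c" for x n
  proof (induction n)
    case (Suc n)
    have "h (x + real n * p + p) = h x + real n * c + c" using assms(2) Suc by simp
    thus ?case by (simp add: algebra_simps)
  qed simp
  obtain n where n: "\<bar>y - h 0\<bar> < real n * c"
    using reals_Archimedean3[OF assms(3)] by blast
  have 1: "h (real n * p) = h 0 + real n * c" using per[of 0] by simp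
  have 2: "h (- real n * p) = h 0 - real n * c" using per[of "- real n * p" n] by simp
  have "connected (range h)"
    by (rule connected_continuous_image[OF assms(1) connected_UNIV])
  hence "y \<in> range h"
    by (rule connectedD_interval[of _ "h (- real n * p)" "h (real n * p)"]) (rule rangeI, rule rangeI, use n 1 2 in auto)
  thus ?thesis by blast
qed

lemma C_k_on_prim:
  assumes "C_k_on k UNIV f" shows "C_k_on k UNIV (prim f)"
proof -
  have "C_k_on (Suc k) UNIV (prim f)"
    by (rule C_k_on_Suc_real[OF _ _ assms])
      (use DERIV_prim[OF C_k_on_imp_continuous_on[OF assms]] in
        \<open>auto simp: has_real_derivative_iff_has_vector_derivative[symmetric]\<close>)
  thus ?thesis by (rule C_k_on_Suc_imp)
qed

lemmas C_k_on_id = C_k_on_bounded_linear[OF _ bounded_linear_ident]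

lemmas C_k_intros = C_k_on_add C_k_on_diff C_k_on_minus C_k_on_mult C_k_on_scaleR C_k_on_const
  C_k_on_Pair C_k_on_fst C_k_on_snd C_k_on_sin C_k_on_cos C_k_on_id

section \<open>First integral and action of the geodesic equation\<close>

locale rot_system =
  fixes L :: real and a b :: "real \<Rightarrow> real"
  assumes L_pos: "L > 0"
    and smooth_a: "\<forall>k. C_k_on k UNIV a" and a_per: "\<And>x. a (x + 1) = a x" and a_pos: "\<And>x. a x > 0"
    and smooth_b: "\<forall>k. C_k_on k UNIV b" and b_per: "\<And>x. b (x + 1) = b x"
    and strict: "\<And>x. \<bar>deriv a x\<bar> < a x * b x"
begin

abbreviation "a' \<equiv> deriv a"

lemma DERIV_a: "(a has_real_derivative a' x) (at x)"
  and smooth_a': "C_k_on k UNIV a'"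
  using C_k_on_deriv[OF smooth_a] by auto

lemma C_k_a: "open U \<Longrightarrow> C_k_on k U f \<Longrightarrow> C_k_on k U (\<lambda>x. a (f x))"
  and C_k_b: "open U \<Longrightarrow> C_k_on k U f \<Longrightarrow> C_k_on k U (\<lambda>x. b (f x))"
  and C_k_a': "open U \<Longrightarrow> C_k_on k U f \<Longrightarrow> C_k_on k U (\<lambda>x. a' (f x))"
  using smooth_a smooth_b smooth_a' by (blast intro: C_k_on_comp_UNIV)+

lemma cont_a: "continuous_on UNIV a" and cont_b: "continuous_on UNIV b" and cont_a': "continuous_on UNIV a'"
  using smooth_a smooth_b smooth_a' C_k_on_imp_continuous_on by blast+

lemma a'_per: "a' (x + 1) = a' x"
proof -
  have "((\<lambda>x. a (x + 1)) has_real_derivative a' (x + 1)) (at x)"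
    using DERIV_a[of "x + 1"] by (simp add: DERIV_shift)
  thus ?thesis unfolding a_per using DERIV_a DERIV_unique by blast
qed

text \<open>\<open>F dy\<close> is a primitive of the two-form
  \<open>b \<mu>_g = a b dx \<and> dy\<close>. On the torus \<open>L * A\<close> is the flux of
  \<open>b\<close> and \<open>L * P 1\<close> is the area, so the average of \<open>b\<close> is
  \<open>A / P 1\<close>. \<open>Q\<close> serves only to compute the mean of
  \<open>J\<close>.\<close>

definition "F = prim (\<lambda>x. a x * b x)"
definition "P = prim a"
definition "Q = prim F"
definition "A = F 1"

lemma cont_ab: "continuous_on UNIV (\<lambda>x. a x * b x)"
  by (intro continuous_on_mult cont_a cont_b)

lemma DERIV_F: "(F has_real_derivative a x * b x) (at x)"
  unfolding F_def by (rule DERIV_prim[OF cont_ab])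

lemma DERIV_P: "(P has_real_derivative a x) (at x)"
  unfolding P_def by (rule DERIV_prim[OF cont_a])

lemma C_k_F: "C_k_on k UNIV F"
  unfolding F_def by (intro C_k_on_prim C_k_on_mult) (use smooth_a smooth_b in auto)

lemma C_k_P: "C_k_on k UNIV P"
  unfolding P_def by (intro C_k_on_prim) (use smooth_a in auto)

lemma C_k_Q: "C_k_on k UNIV Q"
  unfolding Q_def by (intro C_k_on_prim C_k_F)

lemma DERIV_Q: "(Q has_real_derivative F x) (at x)"
  unfolding Q_def by (rule DERIV_prim[OF C_k_on_imp_continuous_on[OF C_k_F]])

lemma F_per: "F (x + 1) = F x + A"
  unfolding F_def A_def by (rule prim_periodic[OF cont_ab]) (simp add: a_per b_per)

lemma P_per: "P (x + 1) = P x + P 1"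
  unfolding P_def by (rule prim_periodic[OF cont_a]) (simp add: a_per)

lemma Q_per: "Q (x + 1) = Q x + A * x + Q 1"
proof -
  have 1: "((\<lambda>x. Q (x + 1)) has_real_derivative F x + A) (at x)" for x
    using DERIV_Q[of "x + 1"] by (simp add: DERIV_shift F_per)
  have 2: "((\<lambda>x. Q x + A * x) has_real_derivative F x + A) (at x)" for x
    by (auto intro!: derivative_eq_intros DERIV_Q)
  have "Q 0 = 0" unfolding Q_def by (rule prim_0[OF C_k_on_imp_continuous_on[OF C_k_F]])
  thus ?thesis using DERIV_eq_diff_const[OF 1 2, of x 0] by simp
qed

text \<open>\<open>H\<close> is the magnetic analogue of the Clairaut integral, up to sign; it comes
  from the invariance under translations in \<open>y\<close>. \<open>W\<close> is its
  \<open>x\<close>-derivative, and \<open>W / a\<close> is the speed of the angle along a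
  geodesic.\<close>

definition "W x \<theta> = a x * b x - a' x * sin \<theta>"
definition "H x \<theta> = F x - a x * sin \<theta>"

text \<open>The worst case is \<open>\<bar>sin \<theta>\<bar> = 1\<close>, and there the claim is
  the hypothesis on \<open>a\<close> and \<open>b\<close>.\<close>

lemma W_pos: "W x \<theta> > 0"
proof -
  have "a' x * sin \<theta> \<le> \<bar>a' x\<bar> * \<bar>sin \<theta>\<bar>" by (metis abs_ge_self abs_mult)
  also have "\<dots> \<le> \<bar>a' x\<bar> * 1" by (intro mult_left_mono) auto
  finally show ?thesis using strict[of x] unfolding W_def by linarith
qed

lemma ab_pos: "a x * b x > 0"
  using strict[of x] by linarith

lemma A_pos: "A > 0"
proof -
  have "F 0 < F 1"
    by (rule DERIV_pos_imp_increasing[of 0 1]) (use DERIV_F ab_pos in auto)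
  moreover have "F 0 = 0" unfolding F_def by (rule prim_0[OF cont_ab])
  ultimately show ?thesis by (simp add: A_def)
qed

lemma DERIV_H: "((\<lambda>x. H x \<theta>) has_real_derivative W x \<theta>) (at x)"
  unfolding H_def W_def by (auto intro!: derivative_eq_intros DERIV_F DERIV_a)

lemma H_strict_mono: "x < y \<Longrightarrow> H x \<theta> < H y \<theta>"
  by (rule DERIV_pos_imp_increasing[of x y "\<lambda>x. H x \<theta>"]) (use DERIV_H W_pos in blast)+

lemma H_inj: "H x \<theta> = H y \<theta> \<longleftrightarrow> x = y"
  by (metis H_strict_mono linorder_neqE_linordered_idom order_less_irrefl)

lemma H_per: "H (x + 1) \<theta> = H x \<theta> + A"
  by (simp add: H_def F_per a_per)

lemma H_surj: "\<exists>x. H x \<theta> = I"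
proof (rule quasi_periodic_surj)
  show "continuous_on UNIV (\<lambda>x. H x \<theta>)"
    by (intro continuous_at_imp_continuous_on ballI) (use DERIV_H DERIV_isCont in blast)
qed (rule H_per, rule A_pos)

text \<open>The inverse of \<open>H\<close> in its first argument. It takes a pair so that joint
  smoothness in level and angle can be expressed by \<open>C_k_on\<close>.\<close>

definition "X p = (THE x. H x (snd p) = fst p)"

lemma H_X: "H (X (I, \<theta>)) \<theta> = I"
  unfolding X_def using H_surj[of \<theta> I] H_inj by (auto intro: theI2)

lemma X_H: "X (H x \<theta>, \<theta>) = x"
  using H_X H_inj by blast

lemma X_eqI: "H x \<theta> = I \<Longrightarrow> X (I, \<theta>) = x"
  using X_H by blast

lemma X_per: "X (I + A, \<theta>) = X (I, \<theta>) + 1"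
  by (rule X_eqI) (simp add: H_per H_X)

lemma X_2pi: "X (I, \<theta> + 2 * pi) = X (I, \<theta>)"
  by (rule X_eqI) (metis H_X H_def sin_periodic)

text \<open>\<open>(I, \<theta>) \<mapsto> (X (I, \<theta>), \<theta>)\<close> is the global inverse
  of \<open>(x, \<theta>) \<mapsto> (H x \<theta>, \<theta>)\<close>, whose derivative is triangular
  with diagonal entries \<open>W\<close> and 1. The inverse function theorem in the plane
  applies.\<close>

lemma has_derivative_X:
  "(X has_derivative (\<lambda>(i, v). (i + a (X p) * cos (snd p) * v) / W (X p) (snd p))) (at p)"
proof -
  obtain I \<theta> where p: "p = (I, \<theta>)" by (cases p)
  define f where "f = (\<lambda>q. (H (fst q) (snd q), snd q :: real))"
  define g where "g = (\<lambda>q. (X q, snd q :: real))"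
  let ?x = "X p"
  let ?f' = "\<lambda>(u, v). (W ?x \<theta> * u - a ?x * cos \<theta> * v, v)"
  let ?g' = "\<lambda>(i, v). ((i + a ?x * cos \<theta> * v) / W ?x \<theta>, v)"
  have dF: "(F has_derivative (\<lambda>u. a x * b x * u)) (at x)" for x
    using DERIV_F by (simp add: has_field_derivative_def)
  have da: "(a has_derivative (\<lambda>u. a' x * u)) (at x)" for x
    using DERIV_a by (simp add: has_field_derivative_def)
  have df: "(f has_derivative (\<lambda>(u, v). (W x \<theta> * u - a x * cos \<theta> * v, v))) (at (x, \<theta>))" for x \<theta>
  proof -
    have 1: "((\<lambda>q. F (fst q)) has_derivative (\<lambda>q. a x * b x * fst q)) (at (x, \<theta>))"
      by (rule has_derivative_compose[where f = fst and g = F and s = UNIV, OF _ dF, of _ "(x, \<theta>)", simplified fst_conv])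
        (auto intro!: derivative_eq_intros)
    have 2: "((\<lambda>q. a (fst q)) has_derivative (\<lambda>q. a' x * fst q)) (at (x, \<theta>))"
      by (rule has_derivative_compose[where f = fst and g = a and s = UNIV, OF _ da, of _ "(x, \<theta>)", simplified fst_conv])
        (auto intro!: derivative_eq_intros)
    show ?thesis unfolding f_def H_def
      by (rule derivative_eq_intros 1 2 refl)+
        (auto simp: fun_eq_iff W_def algebra_simps)
  qed
  have "(g has_derivative ?g') (at (f (?x, \<theta>)))"
  proof (rule has_derivative_inverse_strong[where S = UNIV and f = f and x = "(?x, \<theta>)" and f' = ?f'])
    show "continuous_on UNIV f"
      using has_derivative_continuous[OF df] by (simp add: continuous_on_eq_continuous_at)
    show "g (f q) = q" for q
      by (cases q) (simp add: f_def g_def X_H)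
    show "(f has_derivative ?f') (at (?x, \<theta>))" by (rule df)
    show "?f' \<circ> ?g' = id"
      using W_pos[of ?x \<theta>] by (auto simp: fun_eq_iff field_simps)
  qed auto
  moreover have "f (?x, \<theta>) = p" by (simp add: f_def p H_X)
  ultimately have "(g has_derivative ?g') (at p)" by simp
  from has_derivative_fst[OF this] show ?thesis by (simp add: g_def p case_prod_unfold)
qed

lemma C_k_W: "open U \<Longrightarrow> C_k_on k U f \<Longrightarrow> C_k_on k U g \<Longrightarrow> C_k_on k U (\<lambda>x. W (f x) (g x))"
  unfolding W_def by (intro C_k_intros C_k_a C_k_b C_k_a')

text \<open>Bootstrapping: the derivative of \<open>X\<close> is a smooth expression in
  \<open>X\<close> and the angle, so each order of regularity yields the next.\<close>

lemma C_k_X: "C_k_on k UNIV X"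
proof (induction k)
  case 0
  show ?case using has_derivative_continuous[OF has_derivative_X]
    by (simp add: continuous_on_eq_continuous_at)
next
  case (Suc k)
  show ?case
  proof (rule C_k_on_SucI[OF _ has_derivative_X])
    fix v :: "real \<times> real"
    show "C_k_on k UNIV (\<lambda>x. case v of (i, v) \<Rightarrow> (i + a (X x) * cos (snd x) * v) / W (X x) (snd x))"
      unfolding case_prod_unfold
      by (intro C_k_on_divide C_k_intros C_k_a C_k_W Suc) (auto simp: W_pos[THEN less_imp_neq, symmetric])
  qed auto
qed

text \<open>Along a geodesic parametrised by the angle \<open>\<theta>\<close> of its velocity, \<open>H\<close> is a first integral and
  \<open>dy/d\<theta> = K\<close>.\<close>

definition "K p = sin (snd p) / W (X p) (snd p)"
text \<open>The displacement of \<open>y\<close> on the level \<open>I\<close> while the angle runs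
  from 0 to \<theta>; \<open>G (I, 2 * pi)\<close> is the displacement after one turn.\<close>

definition "G p = prim (\<lambda>s. K (fst p, s)) (snd p)"
definition "J I = integral {0..2*pi} (\<lambda>s. X (I, s) * sin s)"

lemma C_k_K: "C_k_on k UNIV K"
  unfolding K_def by (intro C_k_on_divide C_k_intros C_k_W C_k_X) (auto simp: W_pos[THEN less_imp_neq, symmetric])

lemma cont_K: "continuous_on UNIV (\<lambda>s. K (I, s))"
proof -
  have "continuous_on UNIV (\<lambda>s. (I, s))" by (intro continuous_intros)
  from continuous_on_compose2[OF C_k_on_imp_continuous_on[OF C_k_K] this] show ?thesis by simp
qed

lemma K_2pi: "K (I, s + 2 * pi) = K (I, s)"
  by (simp add: K_def X_2pi W_def)

lemma K_per: "K (I + A, s) = K (I, s)"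
  by (simp add: K_def X_per W_def a_per b_per a'_per)

text \<open>The angle enters \<open>G\<close> as a limit of integration and the level as a
  parameter. After rescaling to the unit interval both are parameters, and differentiation under the
  integral applies.\<close>

lemma C_k_G: "C_k_on k UNIV G"
proof -
  have "C_k_on k UNIV (\<lambda>p. integral {0..1} (\<lambda>u. (\<lambda>q. snd (fst q) * K (fst (fst q), snd (fst q) * snd q)) (p, u)))"
    by (intro C_k_on_integral_param allI C_k_intros C_k_on_comp_UNIV[OF _ C_k_K]) auto
  moreover have "(\<lambda>p. integral {0..1} (\<lambda>u. (\<lambda>q. snd (fst q) * K (fst (fst q), snd (fst q) * snd q)) (p, u))) = G"
    by (simp add: G_def prim_rescale[OF cont_K] fun_eq_iff)
  ultimately show ?thesis by simp
qed

lemma DERIV_G: "((\<lambda>s. G (I, s)) has_real_derivative K (I, \<theta>)) (at \<theta>)"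
  unfolding G_def using DERIV_prim[OF cont_K] by simp

lemma G_per: "G (I + A, \<theta>) = G (I, \<theta>)"
  unfolding G_def by (simp add: K_per)

lemma G_2pi: "G (I, \<theta> + 2 * pi) = G (I, \<theta>) + G (I, 2 * pi)"
  unfolding G_def using prim_periodic[OF cont_K K_2pi] by simp

lemma K_has_integral: "((\<lambda>s. K (I, s)) has_integral G (I, 2 * pi)) {0..2*pi}"
  using prim_has_integral[OF cont_K, of 0 "2*pi" I] by (simp add: G_def prim_0[OF cont_K])

text \<open>Differentiation under the integral: the \<open>I\<close>-derivative of \<open>X\<close>
  is \<open>1 / W\<close>, which turns \<open>X * sin\<close> into \<open>K\<close>.\<close>

lemma DERIV_J: "(J has_real_derivative G (I, 2 * pi)) (at I)"
proof -
  let ?f = "\<lambda>q. X q * sin (snd q)"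
  have "C_k_on 1 UNIV ?f" by (intro C_k_intros C_k_X) auto
  note d = has_derivative_integral_param[OF this, of 0 "2*pi" I]
  have d': "(?f has_derivative (\<lambda>v. X q * (cos (snd q) * snd v) +
      (case v of (i, v) \<Rightarrow> (i + a (X q) * cos (snd q) * v) / W (X q) (snd q)) * sin (snd q))) (at q)" for q
    by (rule derivative_eq_intros has_derivative_X refl)+ (auto simp: fun_eq_iff mult_ac)
  have e: "frechet_derivative ?f (at (I, s)) (v, 0) = v * K (I, s)" for s v
    using fun_cong[OF frechet_derivative_at[OF d'[of "(I, s)"]], of "(v, 0)"] by (simp add: K_def)
  have "integral {0..2*pi} (\<lambda>s. v * K (I, s)) = v * G (I, 2*pi)" for v
    using integral_unique[OF K_has_integral] by simp
  hence "(\<lambda>v. integral {0..2*pi} (\<lambda>s. frechet_derivative ?f (at (I, s)) (v, 0))) = (*) (G (I, 2*pi))"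
    unfolding e by (intro ext) (simp only: mult.commute)
  with d show ?thesis
    by (simp only: has_field_derivative_def J_def[abs_def] snd_conv)
qed

text \<open>Raising the level by \<open>A\<close> raises \<open>X\<close> by 1, and the resulting
  extra term \<open>sin\<close> integrates to 0 over a full turn.\<close>

lemma J_per: "J (I + A) = J I"
proof -
  have c: "continuous_on {0..2*pi} (\<lambda>s. X (I, s) * sin s)"
    by (intro continuous_intros continuous_on_compose2[OF C_k_on_imp_continuous_on[OF C_k_X]]) auto
  have s: "((\<lambda>s. sin s) has_integral (- cos (2*pi)) - (- cos 0)) {0..2*pi}"
    by (rule fundamental_theorem_of_calculus)
      (auto intro!: derivative_eq_intros simp: has_real_derivative_iff_has_vector_derivative[symmetric])
  have "J (I + A) = integral {0..2*pi} (\<lambda>s. X (I, s) * sin s + sin s)"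
    by (simp add: J_def X_per algebra_simps)
  also have "\<dots> = J I + integral {0..2*pi} sin"
    unfolding J_def by (intro integral_add integrable_continuous_real c continuous_intros)
  also have "integral {0..2*pi} sin = (0::real)" using integral_unique[OF s] by simp
  finally show ?thesis by simp
qed

text \<open>\<open>N\<close> is the Legendre transform, at fixed angle, of
  \<open>Q x - P x * sin \<theta>\<close>, whose \<open>x\<close>-derivative is
  \<open>H x \<theta>\<close>. The terms containing the derivative of \<open>X\<close> therefore
  cancel by \<open>H_X\<close>, and the \<open>I\<close>-derivative of \<open>N\<close> is
  \<open>X\<close>. Over one period \<open>N\<close> grows by
  \<open>(A - Q 1) + P 1 * sin s\<close>; after multiplication by \<open>sin s\<close> and
  integration over a turn the constant part disappears and the square of the sine leaves
  \<open>pi * P 1\<close>.\<close>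

lemma J_has_integral: "(J has_integral pi * P 1) {0..A}"
proof -
  \<comment> \<open>\<open>N\<close> is a primitive of \<open>X\<close> in the first variable, so no Fubini argument is needed.\<close>
  define N where "N = (\<lambda>q. X q * fst q - Q (X q) + P (X q) * sin (snd q))"
  let ?f = "\<lambda>q. N q * sin (snd q)"
  define M where "M I = integral {0..2*pi} (\<lambda>s. ?f (I, s))" for I
  have C: "C_k_on k UNIV ?f" for k
    unfolding N_def by (intro C_k_intros C_k_X C_k_on_comp_UNIV[OF _ C_k_Q] C_k_on_comp_UNIV[OF _ C_k_P]) auto
  have dQ: "((\<lambda>q. Q (X q)) has_derivative (\<lambda>v. F (X q) * (case v of (i, v) \<Rightarrow>
      (i + a (X q) * cos (snd q) * v) / W (X q) (snd q)))) (at q)" for q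
    using has_derivative_compose[OF has_derivative_X DERIV_Q[unfolded has_field_derivative_def]] .
  have dP: "((\<lambda>q. P (X q)) has_derivative (\<lambda>v. a (X q) * (case v of (i, v) \<Rightarrow>
      (i + a (X q) * cos (snd q) * v) / W (X q) (snd q)))) (at q)" for q
    using has_derivative_compose[OF has_derivative_X DERIV_P[unfolded has_field_derivative_def]] .
  have e: "frechet_derivative ?f (at (I, s)) (v, 0) = v * (X (I, s) * sin s)" for I s v
  proof -
    let ?q = "(I, s)"
    let ?D = "\<lambda>v. case v of (i, v) \<Rightarrow> (i + a (X ?q) * cos (snd ?q) * v) / W (X ?q) (snd ?q)"
    have "(?f has_derivative (\<lambda>v. N ?q * (cos (snd ?q) * snd v) +
        (X ?q * fst v + ?D v * fst ?q - F (X ?q) * ?D v + (P (X ?q) * (cos (snd ?q) * snd v) +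
        a (X ?q) * ?D v * sin (snd ?q))) * sin (snd ?q))) (at ?q)"
      unfolding N_def
      by (rule derivative_eq_intros has_derivative_X dQ dP refl)+ (auto simp: fun_eq_iff algebra_simps)
    from fun_cong[OF frechet_derivative_at[OF this], of "(v, 0)"]
    have "frechet_derivative ?f (at ?q) (v, 0) =
        (X ?q * v + (v / W (X ?q) s) * (I - F (X ?q) + a (X ?q) * sin s)) * sin s"
      by (simp add: algebra_simps add_divide_distrib)
    also have "I - F (X ?q) + a (X ?q) * sin s = 0"
      using H_X[of I s] by (simp add: H_def)
    finally show ?thesis by simp
  qed
  have "(M has_real_derivative J I) (at I)" for I
  proof -
    have "(\<lambda>v. integral {0..2*pi} (\<lambda>s. frechet_derivative ?f (at (I, s)) (v, 0))) = (*) (J I)"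
      unfolding e J_def integral_mult_right by (intro ext) (simp only: mult.commute)
    with has_derivative_integral_param[OF C, of 0 "2*pi" I] show ?thesis
      by (simp only: has_field_derivative_def M_def[abs_def])
  qed
  hence int: "(J has_integral M A - M 0) {0..A}"
    using A_pos by (intro fundamental_theorem_of_calculus)
      (auto simp: has_real_derivative_iff_has_vector_derivative intro: has_vector_derivative_at_within)
  have NA: "N (A, s) = N (0, s) + (A - Q 1) + P 1 * sin s" for s
    using X_per[of 0 s] Q_per[of "X (0, s)"] P_per[of "X (0, s)"] by (simp add: N_def) (simp add: algebra_simps)
  have c: "continuous_on {0..2*pi} (\<lambda>s. N (0, s) * sin s)"
  proof -
    have "continuous_on {0..2*pi} (\<lambda>s. (0::real, s))" by (intro continuous_intros)
    from continuous_on_compose2[OF C_k_on_imp_continuous_on[OF C[of 0]] this] show ?thesis by simp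
  qed
  have 1: "((\<lambda>s. N (0, s) * sin s) has_integral M 0) {0..2*pi}"
    unfolding M_def using integrable_integral[OF integrable_continuous_real[OF c]] by simp
  have 2: "((\<lambda>s. (A - Q 1) * sin s + P 1 * (sin s)\<^sup>2) has_integral
      (\<lambda>s. - (A - Q 1) * cos s + P 1 * (s - sin s * cos s) / 2) (2*pi) -
      (\<lambda>s. - (A - Q 1) * cos s + P 1 * (s - sin s * cos s) / 2) 0) {0..2*pi}"
  proof (rule fundamental_theorem_of_calculus)
    fix s :: real
    have "(cos s)\<^sup>2 = 1 - (sin s)\<^sup>2" by (simp add: cos_squared_eq)
    hence "((\<lambda>s. - (A - Q 1) * cos s + P 1 * (s - sin s * cos s) / 2) has_real_derivative
      (A - Q 1) * sin s + P 1 * (sin s)\<^sup>2) (at s within {0..2*pi})"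
      by (auto intro!: derivative_eq_intros simp: power2_eq_square) (simp add: algebra_simps)
    thus "((\<lambda>s. - (A - Q 1) * cos s + P 1 * (s - sin s * cos s) / 2) has_vector_derivative
      (A - Q 1) * sin s + P 1 * (sin s)\<^sup>2) (at s within {0..2*pi})"
      by (simp add: has_real_derivative_iff_has_vector_derivative)
  qed auto
  have "((\<lambda>s. N (A, s) * sin s) has_integral M 0 + pi * P 1) {0..2*pi}"
    using has_integral_add[OF 1 2] by (simp add: NA algebra_simps power2_eq_square)
  hence "M A = M 0 + pi * P 1" unfolding M_def by (simp add: integral_unique)
  with int show ?thesis by simp
qed

lemma cont_J: "continuous_on S J"
  using DERIV_J DERIV_isCont continuous_at_imp_continuous_on by blast

lemma J_per_int: "J (I + of_int n * A) = J I"
proof (induction n rule: int_induct[of _ 0])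
  case (step1 n)
  then show ?case using J_per[of "I + of_int n * A"] by (simp add: algebra_simps)
next
  case (step2 n)
  then show ?case using J_per[of "I + of_int (n - 1) * A"] by (simp add: algebra_simps)
qed simp

lemma J_min:
  obtains I0 where "\<And>I. J I0 \<le> J I" "G (I0, 2 * pi) = 0"
    "J I0 \<le> pi * P 1 / A" "J I0 = pi * P 1 / A \<longleftrightarrow> (\<forall>I. G (I, 2 * pi) = 0)"
proof -
  have "\<exists>I\<in>{0..A}. \<forall>y\<in>{0..A}. J I \<le> J y"
    using A_pos by (intro continuous_attains_inf cont_J) auto
  then obtain I0 where I0: "\<forall>y\<in>{0..A}. J I0 \<le> J y" by blast
  have min: "J I0 \<le> J I" for I
  proof -
    \<comment> \<open>The representative of \<open>I\<close> modulo \<open>A\<close> in the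
      fundamental interval.\<close>
    let ?y = "I - of_int \<lfloor>I / A\<rfloor> * A"
    have "?y \<in> {0..A}"
      using floor_divide_lower[OF A_pos, of I] floor_divide_upper[OF A_pos, of I] by (auto simp: algebra_simps)
    moreover have "J ?y = J I" using J_per_int[of ?y "\<lfloor>I / A\<rfloor>"] by simp
    ultimately show ?thesis using I0 by metis
  qed
  \<comment> \<open>By periodicity \<open>I0\<close> minimizes \<open>J\<close> on the whole line,
    so it is a critical point even if it is an endpoint of \<open>{0..A}\<close>.\<close>
  have g0: "G (I0, 2 * pi) = 0"
    by (rule DERIV_local_min[OF DERIV_J, of 1]) (use min in auto)
  have i0: "((\<lambda>_. J I0) has_integral A * J I0) {0..A}"
    using has_integral_const_real[of "J I0" 0 A] A_pos by simp
  have "A * J I0 \<le> pi * P 1"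
    by (rule has_integral_le[OF i0 J_has_integral]) (use min in auto)
  hence le: "J I0 \<le> pi * P 1 / A" using A_pos by (simp add: field_simps)
  have "J I0 = pi * P 1 / A \<longleftrightarrow> (\<forall>I. G (I, 2 * pi) = 0)"
  proof
    assume "J I0 = pi * P 1 / A"
    hence e: "A * J I0 = pi * P 1" using A_pos by (simp add: field_simps)
    \<comment> \<open>A continuous nonnegative function with integral 0 vanishes on the interval; so
      \<open>J\<close> is constant.\<close>
    have "((\<lambda>I. J I - J I0) has_integral 0) {0..A}"
      using has_integral_diff[OF J_has_integral i0] e by simp
    hence z: "J I - J I0 = 0" if "I \<in> {0..A}" for I
      using has_integral_0_cbox_imp_0[of 0 A "\<lambda>I. J I - J I0" I] min that A_pos
        continuous_on_diff[OF cont_J continuous_on_const, of "{0..A}" "J I0"]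
      by auto
    have "J I = J I0" for I
    proof -
      let ?y = "I - of_int \<lfloor>I / A\<rfloor> * A"
      have "?y \<in> {0..A}"
      using floor_divide_lower[OF A_pos, of I] floor_divide_upper[OF A_pos, of I] by (auto simp: algebra_simps)
      moreover have "J ?y = J I" using J_per_int[of ?y "\<lfloor>I / A\<rfloor>"] by simp
      ultimately show ?thesis using z by fastforce
    qed
    hence "J = (\<lambda>_. J I0)" by blast
    hence "(J has_real_derivative 0) (at I)" for I by (metis DERIV_const)
    thus "\<forall>I. G (I, 2 * pi) = 0" using DERIV_J DERIV_unique by blast
  next
    assume "\<forall>I. G (I, 2 * pi) = 0"
    hence "(J has_real_derivative 0) (at I)" for I using DERIV_J by metis
    hence "J I = J I0" for I using DERIV_isconst_all by blast
    hence "A * J I0 = pi * P 1"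
      using has_integral_unique[OF J_has_integral] i0 by (metis (mono_tags, lifting) has_integral_eq)
    thus "J I0 = pi * P 1 / A" using A_pos by (simp add: field_simps)
  qed
  with that min g0 le show thesis by blast
qed

end

section \<open>Geodesics in the angle coordinate\<close>

context rot_system
begin

abbreviation "g \<equiv> rot_metric a"
abbreviation "B \<equiv> (\<lambda>p::plane. b (fst p))"

lemma a_nz: "a x \<noteq> 0"
  using a_pos[of x] by simp

lemma W_nz: "W x \<theta> \<noteq> 0"
  using W_pos[of x \<theta>] by simp

lemma metric_deriv_g: "metric_deriv g p w u v = 2 * a (fst p) * a' (fst p) * fst w * (snd u * snd v)"
proof -
  have "((\<lambda>q. a (fst q)) has_derivative (\<lambda>w. a' (fst p) * fst w)) (at p)"
    by (rule has_derivative_compose[where f = fst and g = a, OF _ DERIV_a[unfolded has_field_derivative_def]])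
      (auto intro!: derivative_eq_intros)
  hence "((\<lambda>q. g q u v) has_derivative
      (\<lambda>w. 2 * a (fst p) * a' (fst p) * fst w * (snd u * snd v))) (at p)"
    unfolding rot_metric_def by (auto intro!: derivative_eq_intros simp: fun_eq_iff)
  from frechet_derivative_at[OF this, symmetric] show ?thesis by (simp add: metric_deriv_def)
qed

lemma christoffel_g:
  "christoffel g p u v = (- a (fst p) * a' (fst p) * snd u * snd v,
     a' (fst p) / a (fst p) * (fst u * snd v + snd u * fst v))" (is "_ = ?z")
  unfolding christoffel_def
proof (rule the_equality)
  show "\<forall>w. 2 * g p ?z w = metric_deriv g p u v w + metric_deriv g p v u w - metric_deriv g p w u v"
    using a_nz[of "fst p"] unfolding metric_deriv_g rot_metric_def
    by (auto simp: field_simps power2_eq_square)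
next
  fix z assume *: "\<forall>w. 2 * g p z w = metric_deriv g p u v w + metric_deriv g p v u w - metric_deriv g p w u v"
  let ?a = "a (fst p)"
  have "(2 * ?a) * (snd z * ?a) = (2 * ?a) * (a' (fst p) * (fst u * snd v + snd u * fst v))"
    using *[rule_format, of "(0, 1)"] unfolding metric_deriv_g rot_metric_def
    by (simp add: algebra_simps power2_eq_square)
  hence "snd z * ?a = a' (fst p) * (fst u * snd v + snd u * fst v)"
    using a_nz[of "fst p"] by simp
  moreover have "fst z = - ?a * a' (fst p) * snd u * snd v"
    using *[rule_format, of "(1, 0)"] unfolding metric_deriv_g rot_metric_def by simp
  ultimately show "z = ?z"
    using a_nz[of "fst p"] by (simp add: prod_eq_iff field_simps)
qed

lemma perp_g:
  assumes "g p v v = 1"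
  shows "perp g p v = (- a (fst p) * snd v, fst v / a (fst p))"
  unfolding perp_def
proof (rule the_equality)
  define r where "r = a (fst p)"
  have r: "r > 0" using a_pos by (simp add: r_def)
  obtain v1 v2 where v: "v = (v1, v2)" by (cases v)
  have one: "v1 * v1 + (r * v2) * (r * v2) = 1"
    using assms by (simp add: rot_metric_def v r_def power2_eq_square algebra_simps)
  show "g p v (- a (fst p) * snd v, fst v / a (fst p)) = 0 \<and>
    g p (- a (fst p) * snd v, fst v / a (fst p)) (- a (fst p) * snd v, fst v / a (fst p)) = g p v v \<and>
    0 \<le> fst v * snd (- a (fst p) * snd v, fst v / a (fst p)) - snd v * fst (- a (fst p) * snd v, fst v / a (fst p))"
    using r by (auto simp: rot_metric_def v r_def[symmetric] field_simps power2_eq_square intro!: add_nonneg_nonneg)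
  fix w assume w: "g p v w = 0 \<and> g p w w = g p v v \<and> 0 \<le> fst v * snd w - snd v * fst w"
  obtain w1 w2 where ww: "w = (w1, w2)" by (cases w)
  let ?k = "v1 * (r * w2) - r * v2 * w1"
  have d: "v1 * w1 + (r * v2) * (r * w2) = 0"
    using w by (simp add: rot_metric_def v ww r_def power2_eq_square algebra_simps)
  have n: "w1 * w1 + (r * w2) * (r * w2) = 1"
    using w assms by (simp add: rot_metric_def v ww r_def power2_eq_square algebra_simps)
  have "?k = r * (v1 * w2 - v2 * w1)" by (simp add: algebra_simps)
  hence k0: "?k \<ge> 0" using w r by (simp add: v ww)
  \<comment> \<open>Lagrange's identity in the orthonormal frame, where \<open>v\<close> and
    \<open>w\<close> have coordinates \<open>(v1, r * v2)\<close> and \<open>(w1, r * w2)\<close>.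
    It gives \<open>?k = 1\<close> up to sign, and the orientation condition fixes the sign.\<close>
  have "?k * ?k = (v1 * v1 + (r * v2) * (r * v2)) * (w1 * w1 + (r * w2) * (r * w2)) -
      (v1 * w1 + (r * v2) * (r * w2)) * (v1 * w1 + (r * v2) * (r * w2))"
    by (simp add: algebra_simps)
  also have "\<dots> = 1" by (simp only: one n d)
  finally have "(?k - 1) * (?k + 1) = 0" by (simp add: algebra_simps)
  hence k: "?k = 1" using k0 by auto
  have "w1 = w1 * (v1 * v1 + (r * v2) * (r * v2))" by (simp only: one)
  also have "\<dots> = v1 * (v1 * w1 + (r * v2) * (r * w2)) - (r * v2) * ?k" by (simp add: algebra_simps)
  finally have 1: "w1 = - r * v2" by (simp only: d k)
  have "r * w2 = (r * w2) * (v1 * v1 + (r * v2) * (r * v2))" by (simp only: one)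
  also have "\<dots> = r * v2 * (v1 * w1 + (r * v2) * (r * w2)) + v1 * ?k" by (simp add: algebra_simps)
  finally have "r * w2 = v1" by (simp only: d k)
  hence 2: "w2 = v1 / r" using r by (simp add: field_simps)
  show "w = (- a (fst p) * snd v, fst v / a (fst p))"
    using 1 2 by (simp add: ww v r_def)
qed

section \<open>The geodesic equation as a first-order system for position and angle\<close>

definition ode :: "(real \<Rightarrow> real) \<Rightarrow> (real \<Rightarrow> real) \<Rightarrow> (real \<Rightarrow> real) \<Rightarrow> bool" where
  "ode x y \<theta> \<longleftrightarrow> (\<forall>t. (x has_real_derivative cos (\<theta> t)) (at t) \<and>
     (y has_real_derivative sin (\<theta> t) / a (x t)) (at t) \<and>
     (\<theta> has_real_derivative W (x t) (\<theta> t) / a (x t)) (at t))"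

lemma odeD:
  assumes "ode x y \<theta>"
  shows "(x has_real_derivative cos (\<theta> t)) (at t)" "(y has_real_derivative sin (\<theta> t) / a (x t)) (at t)"
    "(\<theta> has_real_derivative W (x t) (\<theta> t) / a (x t)) (at t)"
  using assms by (auto simp: ode_def)

lemma unit_vector: "g p (cos \<theta>, sin \<theta> / a (fst p)) (cos \<theta>, sin \<theta> / a (fst p)) = 1"
  using a_nz[of "fst p"] by (simp add: rot_metric_def power2_eq_square[symmetric] power_divide)

lemma unit_vector_angle:
  assumes "g p v v = 1" obtains \<theta> where "v = (cos \<theta>, sin \<theta> / a (fst p))"
proof -
  have "(fst v)\<^sup>2 + (a (fst p) * snd v)\<^sup>2 = 1"
    using assms by (simp add: rot_metric_def power2_eq_square algebra_simps)
  then obtain t where "fst v = cos t" "a (fst p) * snd v = sin t" by (rule sincos_total_2pi) auto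
  hence "v = (cos t, sin t / a (fst p))" using a_nz[of "fst p"] by (simp add: prod_eq_iff field_simps)
  thus thesis by (rule that)
qed

lemma has_vector_derivative_Pair_real:
  assumes "(x has_real_derivative x') (at t)" "(y has_real_derivative y') (at t)"
  shows "((\<lambda>t. (x t, y t)) has_vector_derivative (x', y')) (at t)"
  using assms by (auto simp: has_real_derivative_iff_has_vector_derivative intro: has_vector_derivative_Pair)

lemma ode_velocity:
  assumes "ode x y \<theta>"
  shows "velocity (\<lambda>t. (x t, y t)) = (\<lambda>t. (cos (\<theta> t), sin (\<theta> t) / a (x t)))"
  by (rule ext) (rule vector_derivative_at[OF has_vector_derivative_Pair_real[OF odeD(1,2)[OF assms]]])

lemma ode_imp_geodesic:
  assumes "ode x y \<theta>"
  shows "magnetic_geodesic g B (\<lambda>t. (x t, y t))"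
  unfolding magnetic_geodesic_def
proof (intro allI conjI)
  fix t
  note D = odeD[OF assms, of t]
  let ?\<gamma> = "\<lambda>t. (x t, y t)" and ?w = "W (x t) (\<theta> t) / a (x t)"
  show "?\<gamma> differentiable at t"
    using has_vector_derivative_Pair_real[OF D(1,2)] by (auto simp: has_vector_derivative_def differentiable_def)
  have "((\<lambda>t. cos (\<theta> t)) has_real_derivative - sin (\<theta> t) * ?w) (at t)"
    by (auto intro!: derivative_eq_intros D)
  moreover have "((\<lambda>t. sin (\<theta> t) / a (x t)) has_real_derivative
      (cos (\<theta> t) * ?w * a (x t) - sin (\<theta> t) * (a' (x t) * cos (\<theta> t))) / (a (x t) * a (x t))) (at t)"
    by (rule derivative_eq_intros D DERIV_chain'[OF D(1) DERIV_a] refl a_nz)+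
  ultimately have v: "(velocity ?\<gamma> has_vector_derivative (- sin (\<theta> t) * ?w,
      (cos (\<theta> t) * ?w * a (x t) - sin (\<theta> t) * (a' (x t) * cos (\<theta> t))) / (a (x t) * a (x t)))) (at t)"
    unfolding ode_velocity[OF assms] by (rule has_vector_derivative_Pair_real)
  show "velocity ?\<gamma> differentiable at t"
    using v by (auto simp: has_vector_derivative_def differentiable_def)
  show unit: "g (?\<gamma> t) (velocity ?\<gamma> t) (velocity ?\<gamma> t) = 1"
    using unit_vector[of "?\<gamma> t" "\<theta> t"] fun_cong[OF ode_velocity[OF assms], of t] by simp
  show "covariant_acceleration g ?\<gamma> t = B (?\<gamma> t) *\<^sub>R perp g (?\<gamma> t) (velocity ?\<gamma> t)"
    unfolding covariant_acceleration_def christoffel_g perp_g[OF unit] vector_derivative_at[OF v]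
    unfolding fun_cong[OF ode_velocity[OF assms], of t] using a_nz[of "x t"]
    by (simp add: W_def field_simps)
qed

text \<open>The angle is not obtained by lifting the velocity through a covering: it is defined by
  integrating the angular speed \<open>k\<close>. The frame coordinates \<open>(p, w)\<close> of the
  velocity and the pair \<open>(cos \<theta>, sin \<theta>)\<close> then satisfy the same rotation
  equation, so their squared distance \<open>E\<close> is constant, and it vanishes at time
  0.\<close>

lemma geodesic_imp_ode:
  assumes geo: "magnetic_geodesic g B \<gamma>"
    and v0: "velocity \<gamma> 0 = (cos \<theta>0, sin \<theta>0 / a (fst (\<gamma> 0)))"
  obtains \<theta> where "ode (\<lambda>t. fst (\<gamma> t)) (\<lambda>t. snd (\<gamma> t)) \<theta>" "\<theta> 0 = \<theta>0"
proof -
  define x y p q where "x = (\<lambda>t. fst (\<gamma> t))" and "y = (\<lambda>t. snd (\<gamma> t))"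
    and "p = (\<lambda>t. fst (velocity \<gamma> t))" and "q = (\<lambda>t. snd (velocity \<gamma> t))"
  define c where "c t = vector_derivative (velocity \<gamma>) (at t)" for t
  have unit: "g (\<gamma> t) (velocity \<gamma> t) (velocity \<gamma> t) = 1" for t
    using geo by (simp add: magnetic_geodesic_def)
  have d1: "(\<gamma> has_vector_derivative velocity \<gamma> t) (at t)"
    and d2: "(velocity \<gamma> has_vector_derivative c t) (at t)" for t
    using geo by (simp_all add: magnetic_geodesic_def vector_derivative_works c_def)
  have dx: "(x has_real_derivative p t) (at t)" and dy: "(y has_real_derivative q t) (at t)" for t
    using bounded_linear.has_vector_derivative[OF bounded_linear_fst d1]
      bounded_linear.has_vector_derivative[OF bounded_linear_snd d1]
    by (simp_all add: has_real_derivative_iff_has_vector_derivative x_def y_def p_def q_def)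
  have dp: "(p has_real_derivative fst (c t)) (at t)" and dq: "(q has_real_derivative snd (c t)) (at t)" for t
    using bounded_linear.has_vector_derivative[OF bounded_linear_fst d2]
      bounded_linear.has_vector_derivative[OF bounded_linear_snd d2]
    by (simp_all add: has_real_derivative_iff_has_vector_derivative p_def q_def)
  have "c t + christoffel g (\<gamma> t) (velocity \<gamma> t) (velocity \<gamma> t) =
      b (x t) *\<^sub>R perp g (\<gamma> t) (velocity \<gamma> t)" for t
    using geo by (simp add: magnetic_geodesic_def covariant_acceleration_def c_def x_def)
  hence ceq: "c t = b (x t) *\<^sub>R (- a (x t) * q t, p t / a (x t)) -
      (- a (x t) * a' (x t) * q t * q t, a' (x t) / a (x t) * (p t * q t + q t * p t))" for t
    unfolding christoffel_g perp_g[OF unit] x_def p_def q_def by (metis add_diff_cancel_right')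
  \<comment> \<open>The angular speed \<open>b - (a' / a) * sin \<theta>\<close> with
    \<open>sin \<theta>\<close> expressed by the velocity: the frame component
    \<open>w = a * q\<close> plays the role of the sine.\<close>
  define k where "k t = b (x t) - a' (x t) * q t" for t
  define w where "w t = a (x t) * q t" for t
  have dp': "(p has_real_derivative - k t * w t) (at t)" for t
    using dp[of t] unfolding ceq by (simp add: k_def w_def algebra_simps)
  have dax: "((\<lambda>t. a (x t)) has_real_derivative a' (x t) * p t) (at t)" for t
    by (rule DERIV_chain'[OF dx DERIV_a])
  have dw: "(w has_real_derivative k t * p t) (at t)" for t
    unfolding w_def[abs_def]
    by (rule derivative_eq_intros dax dq refl)+
      (use a_nz[of "x t"] in \<open>simp add: ceq k_def field_simps\<close>)
  have cx: "continuous_on UNIV x" "continuous_on UNIV q"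
    by (auto intro!: continuous_at_imp_continuous_on dx[THEN DERIV_isCont] dq[THEN DERIV_isCont])
  have ck: "continuous_on UNIV k"
    unfolding k_def
    by (intro continuous_intros cx continuous_on_compose2[OF cont_b] continuous_on_compose2[OF cont_a']) auto
  define \<theta> where "\<theta> t = \<theta>0 + prim k t" for t
  have d\<theta>: "(\<theta> has_real_derivative k t) (at t)" for t
    unfolding \<theta>_def by (auto intro!: derivative_eq_intros DERIV_prim[OF ck])
  define E where "E t = (p t - cos (\<theta> t))\<^sup>2 + (w t - sin (\<theta> t))\<^sup>2" for t
  have "(E has_real_derivative 0) (at t)" for t
    unfolding E_def[abs_def]
    by (rule derivative_eq_intros dp' dw d\<theta> refl)+ (simp add: algebra_simps)
  hence "E t = E 0" for t by (metis DERIV_isconst_all)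
  moreover have "E 0 = 0"
    using v0 a_nz[of "x 0"] by (simp add: E_def p_def w_def q_def \<theta>_def prim_0[OF ck] x_def)
  ultimately have "E t = 0" for t by simp
  hence pw: "p t = cos (\<theta> t)" "w t = sin (\<theta> t)" for t
    by (auto simp: E_def sum_power2_eq_zero_iff)
  have "q t = sin (\<theta> t) / a (x t)" for t
    using pw(2)[of t] a_nz[of "x t"] by (simp add: w_def field_simps)
  moreover from this have "k t = W (x t) (\<theta> t) / a (x t)" for t
    by (simp add: k_def W_def a_nz field_simps)
  ultimately have "ode x y \<theta>"
    using dx dy d\<theta> unfolding ode_def pw(1) by metis
  moreover have "\<theta> 0 = \<theta>0" by (simp add: \<theta>_def prim_0[OF ck])
  ultimately show thesis using that by (simp add: x_def y_def)
qed

text \<open>The time elapsed along a geodesic as a function of the angle.\<close>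

definition "S I s = a (X (I, s)) / W (X (I, s)) s"
definition "T I = prim (S I)"

lemma S_pos: "S I s > 0"
  by (simp add: S_def a_pos W_pos)

lemma cont_S: "continuous_on UNIV (S I)"
proof -
  have "C_k_on 0 UNIV (S I)"
    unfolding S_def[abs_def]
    by (intro C_k_on_divide C_k_a C_k_W C_k_on_comp_UNIV[OF _ C_k_X] C_k_intros)
      (auto simp: W_pos[THEN less_imp_neq, symmetric])
  thus ?thesis by simp
qed

lemma DERIV_T: "(T I has_real_derivative S I s) (at s)"
  unfolding T_def by (rule DERIV_prim[OF cont_S])

lemma T_less: "s < s' \<Longrightarrow> T I s < T I s'"
  by (rule DERIV_pos_imp_increasing[of s s']) (use DERIV_T S_pos in blast)+

lemma T_inj: "T I s = T I s' \<longleftrightarrow> s = s'"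
  by (metis T_less linorder_neqE_linordered_idom order_less_irrefl)

lemma T_2pi: "T I (s + 2 * pi) = T I s + T I (2 * pi)"
  unfolding T_def by (rule prim_periodic[OF cont_S]) (simp add: S_def X_2pi W_def)

lemma T_2pi_pos: "T I (2 * pi) > 0"
  using T_less[of 0 "2 * pi" I] prim_0[OF cont_S] by (simp add: T_def)

lemma T_surj: "\<exists>s. T I s = t"
proof (rule quasi_periodic_surj)
  show "continuous_on UNIV (T I)"
    by (intro continuous_at_imp_continuous_on ballI DERIV_T[THEN DERIV_isCont])
qed (rule T_2pi, rule T_2pi_pos)

text \<open>Conservation of \<open>H\<close> determines \<open>x\<close>. Dividing the equations for
  \<open>y\<close> and for time by the one for the angle makes \<open>y\<close> and \<open>t\<close>
  integrals over the angle. Uniqueness, periodicity and the behaviour of the flow are all read off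
  these three formulas.\<close>

lemma ode_solution:
  assumes "ode x y \<theta>" and I: "I = H (x 0) (\<theta> 0)"
  shows "x t = X (I, \<theta> t)" "y t = y 0 + G (I, \<theta> t) - G (I, \<theta> 0)" "T I (\<theta> t) = t + T I (\<theta> 0)"
proof -
  note D = odeD[OF assms(1)]
  have "((\<lambda>t. H (x t) (\<theta> t)) has_real_derivative 0) (at t)" for t
    unfolding H_def
    by (rule derivative_eq_intros DERIV_chain'[OF D(1) DERIV_F] DERIV_chain'[OF D(1) DERIV_a] D(3) refl)+
      (simp add: W_def a_nz field_simps)
  hence "H (x t) (\<theta> t) = H (x 0) (\<theta> 0)" for t by (metis DERIV_isconst_all)
  thus x: "x t = X (I, \<theta> t)" for t using X_H I by metis
  have dG: "((\<lambda>t. G (I, \<theta> t)) has_real_derivative sin (\<theta> t) / a (x t)) (at t)" for t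
    using DERIV_chain'[OF D(3) DERIV_G[of I]] W_nz a_nz
    by (simp add: K_def x[symmetric] field_simps)
  from DERIV_eq_diff_const[OF D(2) dG, of t 0]
  show "y t = y 0 + G (I, \<theta> t) - G (I, \<theta> 0)" by simp
  have dT: "((\<lambda>t. T I (\<theta> t)) has_real_derivative 1) (at t)" for t
    using DERIV_chain'[OF D(3) DERIV_T[of I]] W_nz a_nz
    by (simp add: S_def x[symmetric] field_simps)
  from DERIV_eq_diff_const[OF dT DERIV_ident, of t 0]
  show "T I (\<theta> t) = t + T I (\<theta> 0)" by simp
qed

text \<open>The solution is written down: the angle at time \<open>t\<close> is obtained by
  inverting the elapsed time \<open>T I\<close>, a bijection of the line with positive derivative.
  This also shows that solutions exist for all times.\<close>

lemma ode_exists: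
  obtains x y \<theta> where "ode x y \<theta>" "x 0 = x0" "y 0 = y0" "\<theta> 0 = \<theta>0"
proof -
  define I where "I = H x0 \<theta>0"
  define R where "R t = (THE s. T I s = t)" for t
  have RT: "R (T I s) = s" for s unfolding R_def using T_inj by auto
  have TR: "T I (R t) = t" for t using T_surj[of I t] RT by metis
  have dR: "(R has_real_derivative inverse (S I (R t))) (at t)" for t
  proof -
    have "(R has_real_derivative inverse (S I (R t))) (at (T I (R t)))"
      by (rule has_field_derivative_inverse_strong[OF DERIV_T, of _ _ UNIV])
        (use S_pos[of I "R t"] RT in \<open>auto intro!: continuous_at_imp_continuous_on DERIV_T[THEN DERIV_isCont]\<close>)
    thus ?thesis by (simp add: TR)
  qed
  define \<theta> where "\<theta> t = R (t + T I \<theta>0)" for t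
  define x where "x t = X (I, \<theta> t)" for t
  define y where "y t = y0 + G (I, \<theta> t) - G (I, \<theta>0)" for t
  have d\<theta>: "(\<theta> has_real_derivative W (x t) (\<theta> t) / a (x t)) (at t)" for t
    using DERIV_shift[THEN iffD1, OF dR[of "t + T I \<theta>0"]]
    by (simp add: S_def x_def \<theta>_def[abs_def])
  have dx: "(x has_real_derivative cos (\<theta> t)) (at t)" for t
  proof -
    have "((\<lambda>t. (I, \<theta> t)) has_derivative (\<lambda>h. (0, W (x t) (\<theta> t) / a (x t) * h))) (at t)"
      by (intro has_derivative_Pair has_derivative_const d\<theta>[of t, unfolded has_field_derivative_def])
    from has_derivative_compose[OF this has_derivative_X]
    have "(x has_derivative (\<lambda>h. a (x t) * cos (\<theta> t) * (W (x t) (\<theta> t) / a (x t) * h) / W (x t) (\<theta> t))) (at t)"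
      by (simp add: x_def[abs_def])
    moreover have "(\<lambda>h. a (x t) * cos (\<theta> t) * (W (x t) (\<theta> t) / a (x t) * h) / W (x t) (\<theta> t)) = (*) (cos (\<theta> t))"
      using a_nz[of "x t"] W_pos[of "x t" "\<theta> t"] by (auto simp: fun_eq_iff)
    ultimately show ?thesis by (simp add: has_field_derivative_def)
  qed
  have dy: "(y has_real_derivative sin (\<theta> t) / a (x t)) (at t)" for t
    unfolding y_def[abs_def]
    by (rule derivative_eq_intros DERIV_chain'[OF d\<theta> DERIV_G] refl)+
      (use W_pos[of "x t" "\<theta> t"] in \<open>simp add: K_def x_def[symmetric]\<close>)
  have "ode x y \<theta>" unfolding ode_def using d\<theta> dx dy by blast
  moreover have "\<theta> 0 = \<theta>0" by (simp add: \<theta>_def RT)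
  moreover from this have "x 0 = x0" "y 0 = y0" by (simp_all add: x_def y_def I_def X_H)
  ultimately show thesis using that by blast
qed

lemma ode_unique:
  assumes "ode x y \<theta>" "ode x' y' \<theta>'" "x 0 = x' 0" "y 0 = y' 0" "\<theta> 0 = \<theta>' 0"
  shows "x = x'" "y = y'" "\<theta> = \<theta>'"
proof -
  define I where "I = H (x 0) (\<theta> 0)"
  note 1 = ode_solution[OF assms(1) I_def]
  have "I = H (x' 0) (\<theta>' 0)" using assms by (simp add: I_def)
  note 2 = ode_solution[OF assms(2) this]
  show t: "\<theta> = \<theta>'"
    using 1(3) 2(3) assms(5) by (metis T_inj ext)
  show "x = x'" using 1(1) 2(1) t by (metis ext)
  show "y = y'" using 1(2) 2(2) t assms(4) by (metis ext)
qed

text \<open>The description in \<open>magnetic_flow\<close> is meaningful because every geodesic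
  with the given initial velocity has an angle function with initial value
  \<open>\<theta> 0\<close>, and the system for position and angle has unique solutions.\<close>

lemma magnetic_flow_ode:
  assumes "ode x y \<theta>"
  shows "magnetic_flow g B t ((x 0, y 0), (cos (\<theta> 0), sin (\<theta> 0) / a (x 0))) =
    ((x t, y t), (cos (\<theta> t), sin (\<theta> t) / a (x t)))"
proof -
  let ?\<gamma> = "\<lambda>t. (x t, y t)" and ?v = "(cos (\<theta> 0), sin (\<theta> 0) / a (x 0))"
  have "(THE \<gamma>. magnetic_geodesic g B \<gamma> \<and> \<gamma> 0 = (x 0, y 0) \<and> velocity \<gamma> 0 = ?v) = ?\<gamma>"
  proof (rule the_equality)
    show "magnetic_geodesic g B ?\<gamma> \<and> ?\<gamma> 0 = (x 0, y 0) \<and> velocity ?\<gamma> 0 = ?v"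
      using ode_imp_geodesic[OF assms] fun_cong[OF ode_velocity[OF assms], of 0] by simp
    fix \<gamma> assume \<gamma>: "magnetic_geodesic g B \<gamma> \<and> \<gamma> 0 = (x 0, y 0) \<and> velocity \<gamma> 0 = ?v"
    then obtain \<theta>' where \<theta>': "ode (\<lambda>t. fst (\<gamma> t)) (\<lambda>t. snd (\<gamma> t)) \<theta>'" "\<theta>' 0 = \<theta> 0"
      using geodesic_imp_ode[of \<gamma> "\<theta> 0"] by auto
    have 0: "x 0 = fst (\<gamma> 0)" "y 0 = snd (\<gamma> 0)" using \<gamma> by auto
    show "\<gamma> = ?\<gamma>"
      unfolding ode_unique(1,2)[OF assms \<theta>'(1) 0 \<theta>'(2)[symmetric]] by simp
  qed
  thus ?thesis unfolding magnetic_flow_def using fun_cong[OF ode_velocity[OF assms], of t] by simp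
qed

text \<open>The components of a solution are smooth because their derivatives are smooth functions of
  themselves.\<close>

lemma C_k_ode:
  assumes "ode x y \<theta>"
  shows "C_k_on k UNIV x \<and> C_k_on k UNIV y \<and> C_k_on k UNIV \<theta>"
proof (induction k)
  case 0
  show ?case
    by (auto intro!: continuous_at_imp_continuous_on odeD[OF assms, THEN DERIV_isCont])
next
  case (Suc k)
  have "C_k_on (Suc k) UNIV x"
    by (rule C_k_on_Suc_real[of _ _ "\<lambda>t. cos (\<theta> t)"])
      (use Suc odeD[OF assms] in \<open>auto intro: C_k_on_cos simp: has_real_derivative_iff_has_vector_derivative[symmetric]\<close>)
  moreover have "C_k_on (Suc k) UNIV y"
    by (rule C_k_on_Suc_real[of _ _ "\<lambda>t. sin (\<theta> t) / a (x t)"])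
      (use Suc odeD[OF assms] a_nz in \<open>auto intro!: C_k_on_sin C_k_on_divide C_k_a simp: has_real_derivative_iff_has_vector_derivative[symmetric]\<close>)
  moreover have "C_k_on (Suc k) UNIV \<theta>"
    by (rule C_k_on_Suc_real[of _ _ "\<lambda>t. W (x t) (\<theta> t) / a (x t)"])
      (use Suc odeD[OF assms] a_nz in \<open>auto intro!: C_k_W C_k_on_divide C_k_a simp: has_real_derivative_iff_has_vector_derivative[symmetric]\<close>)
  ultimately show ?case by blast
qed

end

section \<open>Magnetic length of closed geodesics\<close>

abbreviation part1 :: "(real \<times> real \<Rightarrow> 'b::real_normed_vector) \<Rightarrow> real \<times> real \<Rightarrow> 'b" where
  "part1 f p \<equiv> frechet_derivative f (at p) (1, 0)"

abbreviation part2 :: "(real \<times> real \<Rightarrow> 'b::real_normed_vector) \<Rightarrow> real \<times> real \<Rightarrow> 'b" where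
  "part2 f p \<equiv> frechet_derivative f (at p) (0, 1)"

lemma has_derivative_frechet: "C_k_on 1 UNIV f \<Longrightarrow> (f has_derivative frechet_derivative f (at p)) (at p)"
  using C_k_on_SucD[OF open_UNIV, of 0 f p] by (simp only: One_nat_def UNIV_I)

lemma has_derivative_part1: "C_k_on 1 UNIV f \<Longrightarrow> ((\<lambda>s. f (s, t)) has_vector_derivative part1 f (s, t)) (at s)"
  and has_derivative_part2: "C_k_on 1 UNIV f \<Longrightarrow> ((\<lambda>t. f (s, t)) has_vector_derivative part2 f (s, t)) (at t)"
proof -
  assume f: "C_k_on 1 UNIV f"
  note d = has_derivative_frechet[OF f, of "(s, t)"]
  have "((\<lambda>s. (s, t)) has_derivative (\<lambda>h. (h, 0))) (at s)"
    by (auto intro!: derivative_eq_intros)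
  from has_derivative_compose[OF this d]
  have "((\<lambda>s. f (s, t)) has_derivative (\<lambda>h. frechet_derivative f (at (s, t)) (h, 0))) (at s)" .
  moreover have "(\<lambda>h. frechet_derivative f (at (s, t)) (h, 0)) = (\<lambda>h. h *\<^sub>R part1 f (s, t))"
    unfolding linear_scale[OF has_derivative_linear[OF d], symmetric] by simp
  ultimately show "((\<lambda>s. f (s, t)) has_vector_derivative part1 f (s, t)) (at s)"
    by (simp only: has_vector_derivative_def)
  have "((\<lambda>t. (s, t)) has_derivative (\<lambda>h. (0, h))) (at t)"
    by (auto intro!: derivative_eq_intros)
  from has_derivative_compose[OF this d]
  have "((\<lambda>t. f (s, t)) has_derivative (\<lambda>h. frechet_derivative f (at (s, t)) (0, h))) (at t)" .
  moreover have "(\<lambda>h. frechet_derivative f (at (s, t)) (0, h)) = (\<lambda>h. h *\<^sub>R part2 f (s, t))"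
    unfolding linear_scale[OF has_derivative_linear[OF d], symmetric] by simp
  ultimately show "((\<lambda>t. f (s, t)) has_vector_derivative part2 f (s, t)) (at t)"
    by (simp only: has_vector_derivative_def)
qed

lemma C_k_on_part:
  assumes "\<forall>k. C_k_on k UNIV f"
  shows "C_k_on k UNIV (\<lambda>p. frechet_derivative f (at p) w)"
  using assms C_k_on.simps(2) by blast

lemma continuous_on_slice:
  assumes "continuous_on UNIV f"
  shows "continuous_on A (\<lambda>t. f (s, t))" "continuous_on A (\<lambda>s. f (s, t))"
proof -
  have "continuous_on A (\<lambda>t. (s, t))" "continuous_on A (\<lambda>s. (s, t))" by (intro continuous_intros)+
  from this[THEN continuous_on_compose2[OF assms]]
  show "continuous_on A (\<lambda>t. f (s, t))" "continuous_on A (\<lambda>s. f (s, t))" by auto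
qed

text \<open>Symmetry of second derivatives, obtained by differentiating
  \<open>f (s, t) - f (s, c) = \<integral>\<^sub>c\<^sup>t f\<^sub>t (s, r) dr\<close> with respect to \<open>s\<close> and then with respect to \<open>t\<close>.\<close>

lemma part1_part2_commute:
  fixes f :: "real \<times> real \<Rightarrow> real"
  assumes f: "\<forall>k. C_k_on k UNIV f"
  shows "part1 (part2 f) p = part2 (part1 f) p"
proof -
  obtain s t where p: "p = (s, t)" by (cases p)
  \<comment> \<open>Any base point strictly to the left of \<open>t\<close> would do: the formula
    for \<tau> > c then holds on a neighbourhood of \<open>t\<close> and can be differentiated
    there.\<close>
  define c where "c = t - 1"
  define h where "h r = part1 (part2 f) (s, r)" for r
  note C = C_k_on_part[OF f]
  have ch: "continuous_on UNIV h"
    unfolding h_def[abs_def]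
    by (rule continuous_on_slice[OF C_k_on_imp_continuous_on[OF C_k_on_part]]) (use C in blast)
  have eq: "prim h \<tau> + (part1 f (s, c) - prim h c) = part1 f (s, \<tau>)" if "\<tau> > c" for \<tau>
  proof -
    have e: "f (\<sigma>, \<tau>) - f (\<sigma>, c) = integral {c..\<tau>} (\<lambda>r. part2 f (\<sigma>, r))" for \<sigma>
      using has_derivative_part2[OF f[rule_format]] that
      by (intro integral_unique[symmetric] fundamental_theorem_of_calculus)
        (auto intro: has_vector_derivative_at_within)
    have "((\<lambda>\<sigma>. integral {c..\<tau>} (\<lambda>r. part2 f (\<sigma>, r))) has_derivative
       (\<lambda>v. integral {c..\<tau>} (\<lambda>r. frechet_derivative (part2 f) (at (s, r)) (v, 0)))) (at s)"
      by (rule has_derivative_integral_param) (rule C)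
    hence "((\<lambda>\<sigma>. integral {c..\<tau>} (\<lambda>r. part2 f (\<sigma>, r))) has_vector_derivative integral {c..\<tau>} h) (at s)"
      unfolding has_vector_derivative_def h_def
    proof (rule has_derivative_eq_rhs)
      have d: "(part2 f has_derivative frechet_derivative (part2 f) (at q)) (at q)" for q
        by (rule has_derivative_frechet[OF C])
      have e: "frechet_derivative (part2 f) (at (s, r)) (v, 0) = v *\<^sub>R part1 (part2 f) (s, r)" for v r
        unfolding linear_scale[OF has_derivative_linear[OF d], symmetric] by simp
      show "(\<lambda>v. integral {c..\<tau>} (\<lambda>r. frechet_derivative (part2 f) (at (s, r)) (v, 0))) =
          (\<lambda>v. v *\<^sub>R integral {c..\<tau>} (\<lambda>r. part1 (part2 f) (s, r)))"
      proof
        fix v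
        show "integral {c..\<tau>} (\<lambda>r. frechet_derivative (part2 f) (at (s, r)) (v, 0)) =
            v *\<^sub>R integral {c..\<tau>} (\<lambda>r. part1 (part2 f) (s, r))"
          by (rule trans[OF arg_cong[where f = "integral {c..\<tau>}", OF ext] integral_cmul]) (rule e)
      qed
    qed
    moreover have "((\<lambda>\<sigma>. f (\<sigma>, \<tau>) - f (\<sigma>, c)) has_vector_derivative part1 f (s, \<tau>) - part1 f (s, c)) (at s)"
      by (intro has_vector_derivative_diff has_derivative_part1 f[rule_format])
    ultimately have "part1 f (s, \<tau>) - part1 f (s, c) = integral {c..\<tau>} h"
      unfolding e by (rule vector_derivative_unique_at[rotated])
    also have "\<dots> = prim h \<tau> - prim h c"
      using that by (intro integral_unique prim_has_integral[OF ch]) simp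
    finally show ?thesis by simp
  qed
  have "((\<lambda>\<tau>. prim h \<tau> + (part1 f (s, c) - prim h c)) has_real_derivative h t) (at t)"
    by (auto intro!: derivative_eq_intros DERIV_prim[OF ch])
  hence "((\<lambda>\<tau>. part1 f (s, \<tau>)) has_real_derivative h t) (at t)"
    by (rule has_field_derivative_transform_within_open[of _ "h t" t "{c<..}"]) (simp_all add: c_def eq[unfolded c_def])
  moreover have "((\<lambda>\<tau>. part1 f (s, \<tau>)) has_real_derivative part2 (part1 f) (s, t)) (at t)"
    using has_derivative_part2[OF C] by (simp add: has_real_derivative_iff_has_vector_derivative)
  ultimately show ?thesis unfolding p h_def by (rule DERIV_unique)
qed

text \<open>Stokes' theorem for the one-form \<open>F(u) dv\<close>, whose exterior derivative is
  \<open>f(u) du \<and> dv\<close>. The second derivatives of \<open>v\<close> produced by the two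
  partial derivatives cancel by symmetry.\<close>

lemma stokes_rectangle:
  fixes u v :: "real \<times> real \<Rightarrow> real"
  assumes u: "\<forall>k. C_k_on k UNIV u" and v: "\<forall>k. C_k_on k UNIV v"
    and F: "\<And>x. (F has_real_derivative f x) (at x)" and f: "continuous_on UNIV f"
    and \<tau>: "\<tau> > 0"
  shows "integral (cbox (0,0) (1,\<tau>)) (\<lambda>p. f (u p) * (part1 u p * part2 v p - part2 u p * part1 v p)) =
    integral {0..\<tau>} (\<lambda>t. F (u (1, t)) * part2 v (1, t) - F (u (0, t)) * part2 v (0, t)) -
    integral {0..1} (\<lambda>s. F (u (s, \<tau>)) * part1 v (s, \<tau>) - F (u (s, 0)) * part1 v (s, 0))"
proof -
  note Cu = C_k_on_part[OF u] and Cv = C_k_on_part[OF v]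
  define \<phi>' where "\<phi>' p = f (u p) * part1 u p * part2 v p + F (u p) * part1 (part2 v) p" for p
  define \<psi>' where "\<psi>' p = f (u p) * part2 u p * part1 v p + F (u p) * part2 (part1 v) p" for p
  have cF: "continuous_on UNIV F"
    by (intro continuous_at_imp_continuous_on ballI F[THEN DERIV_isCont])
  note c0 = C_k_on_imp_continuous_on[OF u[rule_format, of 0]] C_k_on_imp_continuous_on[OF Cu[of 0]]
    C_k_on_imp_continuous_on[OF Cv[of 0]] C_k_on_imp_continuous_on[OF C_k_on_part[of "\<lambda>p. frechet_derivative v (at p) w" for w, OF allI[OF Cv], of 0]]
  have c\<phi>: "continuous_on UNIV \<phi>'" "continuous_on UNIV \<psi>'"
    unfolding \<phi>'_def \<psi>'_def
    by (intro continuous_intros c0 continuous_on_compose2[OF f] continuous_on_compose2[OF cF]; simp)+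
  have d1: "((\<lambda>s. F (u (s, t)) * part2 v (s, t)) has_real_derivative \<phi>' (s, t)) (at s)" for s t
    unfolding \<phi>'_def
    by (rule derivative_eq_intros DERIV_chain'[OF _ F]
        has_derivative_part1[OF u[rule_format], folded has_real_derivative_iff_has_vector_derivative]
        has_derivative_part1[OF Cv, folded has_real_derivative_iff_has_vector_derivative] refl)+ simp
  have d2: "((\<lambda>t. F (u (s, t)) * part1 v (s, t)) has_real_derivative \<psi>' (s, t)) (at t)" for s t
    unfolding \<psi>'_def
    by (rule derivative_eq_intros DERIV_chain'[OF _ F]
        has_derivative_part2[OF u[rule_format], folded has_real_derivative_iff_has_vector_derivative]
        has_derivative_part2[OF Cv, folded has_real_derivative_iff_has_vector_derivative] refl)+ simp
  have i1: "integral {0..1} (\<lambda>s. \<phi>' (s, t)) = F (u (1, t)) * part2 v (1, t) - F (u (0, t)) * part2 v (0, t)" for t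
    using d1 by (intro integral_unique fundamental_theorem_of_calculus)
      (auto simp: has_real_derivative_iff_has_vector_derivative intro: has_vector_derivative_at_within)
  have i2: "integral {0..\<tau>} (\<lambda>t. \<psi>' (s, t)) = F (u (s, \<tau>)) * part1 v (s, \<tau>) - F (u (s, 0)) * part1 v (s, 0)" for s
    using d2 \<tau> by (intro integral_unique fundamental_theorem_of_calculus)
      (auto simp: has_real_derivative_iff_has_vector_derivative intro: has_vector_derivative_at_within)
  have "integral (cbox (0,0) (1,\<tau>)) (\<lambda>p. f (u p) * (part1 u p * part2 v p - part2 u p * part1 v p)) =
      integral (cbox (0,0) (1,\<tau>)) (\<lambda>p. \<phi>' p - \<psi>' p)"
    unfolding \<phi>'_def \<psi>'_def part1_part2_commute[OF v] by (simp add: algebra_simps)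
  also have "\<dots> = integral (cbox (0,0) (1,\<tau>)) \<phi>' - integral (cbox (0,0) (1,\<tau>)) \<psi>'"
    by (intro integral_diff integrable_continuous continuous_on_subset[OF c\<phi>(1)] continuous_on_subset[OF c\<phi>(2)]) auto
  also have "integral (cbox (0,0) (1,\<tau>)) \<phi>' = integral {0..\<tau>} (\<lambda>t. integral {0..1} (\<lambda>s. \<phi>' (s, t)))"
    using integral_prod_continuous[OF continuous_on_subset[OF c\<phi>(1)], of 0 0 1 \<tau>]
      integral_swap_continuous[of 0 0 1 \<tau> "\<lambda>s t. \<phi>' (s, t)"] continuous_on_subset[OF c\<phi>(1)]
    by simp
  also have "integral (cbox (0,0) (1,\<tau>)) \<psi>' = integral {0..1} (\<lambda>s. integral {0..\<tau>} (\<lambda>t. \<psi>' (s, t)))"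
    using integral_prod_continuous[OF continuous_on_subset[OF c\<phi>(2)], of 0 0 1 \<tau>] by simp
  finally show ?thesis unfolding i1 i2 .
qed

context rot_system
begin

lemma area_form_g: "area_form g p w z = a (fst p) * (fst w * snd z - snd w * fst z)"
  using a_pos[of "fst p"] by (simp add: area_form_def rot_metric_def real_sqrt_abs abs_of_pos)

text \<open>\<open>b \<mu>_g\<close> is the exterior derivative of \<open>F dy\<close>. In polar
  coordinates the side \<open>s = 0\<close> contributes nothing because the disc is constant there,
  and the sides \<open>t = 0\<close> and \<open>t = \<tau>\<close> cancel. What remains depends on
  the boundary curve alone, hence not on the disc selected by \<open>SOME\<close>.\<close>

lemma disc_integral_eq:
  assumes disc: "capping_disc \<gamma> \<tau> \<Gamma>" and \<tau>: "\<tau> > 0" and ode: "ode x y \<theta>" and \<gamma>: "\<gamma> = (\<lambda>t. (x t, y t))"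
  shows "disc_integral g B \<tau> \<Gamma> = integral {0..\<tau>} (\<lambda>t. F (x t) * (sin (\<theta> t) / a (x t)))"
proof -
  define u v where "u = (\<lambda>p. fst (\<Gamma> p))" and "v = (\<lambda>p. snd (\<Gamma> p))"
  have \<Gamma>: "\<forall>k. C_k_on k UNIV \<Gamma>" using disc by (simp add: capping_disc_def smooth_on_UNIV_iff)
  have u: "\<forall>k. C_k_on k UNIV u" and v: "\<forall>k. C_k_on k UNIV v"
    unfolding u_def v_def using \<Gamma> by (blast intro: C_k_on_fst C_k_on_snd)+
  have "frechet_derivative u (at p) w = fst (frechet_derivative \<Gamma> (at p) w)"
    "frechet_derivative v (at p) w = snd (frechet_derivative \<Gamma> (at p) w)" for p w
    unfolding u_def v_def
    using frechet_derivative_at[OF has_derivative_fst[OF has_derivative_frechet[OF \<Gamma>[rule_format]]]]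
      frechet_derivative_at[OF has_derivative_snd[OF has_derivative_frechet[OF \<Gamma>[rule_format]]]]
    by metis+
  note fr = this[symmetric]
  have "disc_integral g B \<tau> \<Gamma> = integral (cbox (0,0) (1,\<tau>))
      (\<lambda>p. a (u p) * b (u p) * (part1 u p * part2 v p - part2 u p * part1 v p))"
    unfolding disc_integral_def area_form_g fr by (simp add: u_def mult_ac)
  also have "\<dots> = integral {0..\<tau>} (\<lambda>t. F (u (1, t)) * part2 v (1, t) - F (u (0, t)) * part2 v (0, t)) -
    integral {0..1} (\<lambda>s. F (u (s, \<tau>)) * part1 v (s, \<tau>) - F (u (s, 0)) * part1 v (s, 0))"
    by (rule stokes_rectangle[OF u v DERIV_F cont_ab \<tau>])
  also have "integral {0..1} (\<lambda>s. F (u (s, \<tau>)) * part1 v (s, \<tau>) - F (u (s, 0)) * part1 v (s, 0)) = 0"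
  proof (rule integral_unique)
    \<comment> \<open>Periodicity of the disc is known for \<open>s\<close> in \<open>{0..1}\<close>
      only, so the \<open>s\<close>-derivatives on the two sides can be compared at interior points;
      the endpoints do not affect the integral.\<close>
    have per: "u (s, \<tau>) = u (s, 0)" "v (s, \<tau>) = v (s, 0)" if "s \<in> {0<..<1}" for s
    proof -
      have "\<Gamma> (s, 0 + \<tau>) = \<Gamma> (s, 0)"
        using disc that unfolding capping_disc_def by (meson atLeastAtMost_iff greaterThanLessThan_iff less_imp_le)
      thus "u (s, \<tau>) = u (s, 0)" "v (s, \<tau>) = v (s, 0)" by (simp_all add: u_def v_def)
    qed
    have "part1 v (s, \<tau>) = part1 v (s, 0)" if "s \<in> {0<..<1}" for s
    proof (rule vector_derivative_unique_at[OF has_derivative_part1[OF v[rule_format]]])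
      show "((\<lambda>s. v (s, \<tau>)) has_vector_derivative part1 v (s, 0)) (at s)"
        by (rule has_vector_derivative_transform_within_open[OF has_derivative_part1[OF v[rule_format]],
              of "{0<..<1}"]) (use that per in auto)
    qed
    hence "((\<lambda>s. F (u (s, \<tau>)) * part1 v (s, \<tau>) - F (u (s, 0)) * part1 v (s, 0)) has_integral 0) (cbox 0 1)"
      by (intro has_integral_spike_interior[OF has_integral_0]) (simp add: per)
    thus "((\<lambda>s. F (u (s, \<tau>)) * part1 v (s, \<tau>) - F (u (s, 0)) * part1 v (s, 0)) has_integral 0) {0..1}"
      by simp
  qed
  also have "(\<lambda>t. F (u (1, t)) * part2 v (1, t) - F (u (0, t)) * part2 v (0, t)) =
      (\<lambda>t. F (x t) * (sin (\<theta> t) / a (x t)))"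
  proof
    fix t
    have 1: "\<Gamma> (1, t) = (x t, y t)" and 0: "\<Gamma> (0, t) = \<Gamma> (0, 0)" for t
      using disc unfolding capping_disc_def \<gamma> by blast+
    have "(y has_vector_derivative part2 v (1, t)) (at t)"
      using has_derivative_part2[OF v[rule_format], of 1 t] by (simp add: v_def 1)
    hence "part2 v (1, t) = sin (\<theta> t) / a (x t)"
      using odeD(2)[OF ode, of t] vector_derivative_unique_at
      by (auto simp: has_real_derivative_iff_has_vector_derivative)
    moreover have "((\<lambda>t. v (0, t)) has_vector_derivative 0) (at t)"
      unfolding v_def by (subst 0) simp
    hence "part2 v (0, t) = 0"
      using has_derivative_part2[OF v[rule_format]] vector_derivative_unique_at by blast
    ultimately show "F (u (1, t)) * part2 v (1, t) - F (u (0, t)) * part2 v (0, t) =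
        F (x t) * (sin (\<theta> t) / a (x t))" by (simp add: u_def 1)
  qed
  finally show ?thesis by simp
qed

lemma smooth_curve:
  assumes "ode x y \<theta>" shows "C_k_on k UNIV (\<lambda>t. (x t, y t))"
  using C_k_ode[OF assms] by (blast intro: C_k_on_Pair)

lemma magnetic_length_closed:
  assumes ode: "ode x y \<theta>" and \<tau>: "\<tau> > 0"
    and per: "\<And>t. x (t + \<tau>) = x t" "\<And>t. y (t + \<tau>) = y t" and rot: "\<theta> \<tau> = \<theta> 0 + 2 * pi"
  shows "magnetic_length g B (\<lambda>t. (x t, y t), \<tau>) = J (H (x 0) (\<theta> 0))"
proof -
  let ?\<gamma> = "\<lambda>t. (x t, y t)"
  note D = odeD[OF ode]
  define I where "I = H (x 0) (\<theta> 0)"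
  note X = ode_solution(1)[OF ode I_def]
  \<comment> \<open>The cone over the curve with apex at the origin is a capping disc, so the choice
    in \<open>magnetic_length\<close> is not vacuous.\<close>
  have "smooth_on UNIV (\<lambda>p. fst p *\<^sub>R ?\<gamma> (snd p))"
    unfolding smooth_on_UNIV_iff
    by (intro allI C_k_on_scaleR C_k_on_fst C_k_on_comp_UNIV[OF _ smooth_curve[OF ode]] C_k_on_snd C_k_on_id) auto
  hence "capping_disc ?\<gamma> \<tau> (\<lambda>p. fst p *\<^sub>R ?\<gamma> (snd p))"
    by (simp add: capping_disc_def per)
  from someI[of "capping_disc ?\<gamma> \<tau>", OF this]
  have disc: "disc_integral g B \<tau> (SOME \<Gamma>. capping_disc ?\<gamma> \<tau> \<Gamma>) =
      integral {0..\<tau>} (\<lambda>t. F (x t) * (sin (\<theta> t) / a (x t)))"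
    by (rule disc_integral_eq[OF _ \<tau> ode refl])
  have len: "curve_length g (?\<gamma>, \<tau>) = \<tau>"
    using unit_vector[of "?\<gamma> t" "\<theta> t" for t] \<tau>
    by (simp add: curve_length_def fun_cong[OF ode_velocity[OF ode]])
  define R where "R = prim (\<lambda>s. X (I, s) * sin s)"
  have cX: "continuous_on UNIV (\<lambda>s. X (I, s) * sin s)"
    by (intro continuous_intros continuous_on_slice C_k_on_imp_continuous_on[OF C_k_X])
  \<comment> \<open>With \<open>F = I + a * sin \<theta>\<close> the integrand is the square of
    \<open>cos \<theta>\<close> minus \<open>I\<close> times the derivative of \<open>y\<close>. The
    first term comes from differentiating \<open>x * cos \<theta>\<close>; the surplus
    \<open>- x * sin \<theta>\<close> times the angular speed is compensated by \<open>R\<close>.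
    Over one period only \<open>R\<close> changes, and it grows by \<open>J I\<close>.\<close>
  have "((\<lambda>t. x t * cos (\<theta> t) + R (\<theta> t) - I * y t) has_real_derivative
      1 - F (x t) * (sin (\<theta> t) / a (x t))) (at t)" for t
  proof -
    have h: "F (x t) = I + a (x t) * sin (\<theta> t)" using H_X[of I "\<theta> t"] by (simp add: X[symmetric] H_def)
    have c: "cos (\<theta> t) * cos (\<theta> t) = 1 - sin (\<theta> t) * sin (\<theta> t)"
      using sin_cos_squared_add[of "\<theta> t"] by (simp add: power2_eq_square algebra_simps)
    show ?thesis unfolding R_def
      by (rule derivative_eq_intros D DERIV_chain'[OF D(3) DERIV_prim[OF cX]] refl)+
        (use a_nz[of "x t"] in \<open>simp add: X[symmetric] h c field_simps\<close>)
  qed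
  hence "((\<lambda>t. 1 - F (x t) * (sin (\<theta> t) / a (x t))) has_integral
      (x \<tau> * cos (\<theta> \<tau>) + R (\<theta> \<tau>) - I * y \<tau>) - (x 0 * cos (\<theta> 0) + R (\<theta> 0) - I * y 0)) {0..\<tau>}"
    using \<tau> by (intro fundamental_theorem_of_calculus)
      (auto simp: has_real_derivative_iff_has_vector_derivative intro: has_vector_derivative_at_within)
  moreover have "R (\<theta> \<tau>) = R (\<theta> 0) + R (2 * pi)"
    unfolding rot R_def by (rule prim_periodic[OF cX]) (simp add: X_2pi)
  moreover have "x \<tau> = x 0" "y \<tau> = y 0" using per[of 0] by simp_all
  moreover have "R (2 * pi) = J I"
    using integral_unique[OF prim_has_integral[OF cX, of 0 "2 * pi"]] by (simp add: J_def R_def prim_0[OF cX])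
  ultimately have *: "((\<lambda>t. 1 - F (x t) * (sin (\<theta> t) / a (x t))) has_integral J I) {0..\<tau>}"
    by (simp add: rot)
  have "((\<lambda>t. 1 - (1 - F (x t) * (sin (\<theta> t) / a (x t)))) has_integral \<tau> - J I) {0..\<tau>}"
    using has_integral_diff[OF has_integral_const_real[of 1 0 \<tau>] *] \<tau> by simp
  hence "integral {0..\<tau>} (\<lambda>t. F (x t) * (sin (\<theta> t) / a (x t))) = \<tau> - J I"
    by (simp add: integral_unique)
  thus ?thesis by (simp add: magnetic_length_def len disc I_def)
qed

end

section \<open>Closed geodesics in the class of the fibres\<close>

text \<open>The velocity has components \<open>cos \<theta>\<close> and
  \<open>sin \<theta> / a\<close>, so it moves on an ellipse whose axes vary. The linear homotopy to
  the unit circle multiplies each coordinate by a positive factor and thus avoids 0.\<close>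

lemma winding_number_cis_deformed:
  fixes \<phi> \<alpha> \<beta> :: "real \<Rightarrow> real"
  assumes cont: "continuous_on {0..1} \<phi>" "continuous_on {0..1} \<alpha>" "continuous_on {0..1} \<beta>"
    and pos: "\<And>s. s \<in> {0..1} \<Longrightarrow> \<alpha> s > 0" "\<And>s. s \<in> {0..1} \<Longrightarrow> \<beta> s > 0"
    and closed: "cis (\<phi> 1) = cis (\<phi> 0)" "\<alpha> 1 = \<alpha> 0" "\<beta> 1 = \<beta> 0"
  shows "winding_number (\<lambda>s. Complex (\<alpha> s * cos (\<phi> s)) (\<beta> s * sin (\<phi> s))) 0 = (\<phi> 1 - \<phi> 0) / (2 * pi)"
proof -
  let ?p = "\<lambda>s. Complex (\<alpha> s * cos (\<phi> s)) (\<beta> s * sin (\<phi> s))" and ?q = "\<lambda>s. cis (\<phi> s)"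
  have cs: "cos (\<phi> 1) = cos (\<phi> 0)" "sin (\<phi> 1) = sin (\<phi> 0)"
    using closed(1) by (simp_all add: complex_eq_iff)
  have "homotopic_loops (- {0}) ?p ?q"
  proof (rule homotopic_loops_linear)
    show "path ?p" unfolding path_def Complex_eq by (intro continuous_intros cont)
    show "path ?q" unfolding path_def by (intro continuous_intros cont)
    show "pathfinish ?p = pathstart ?p" "pathfinish ?q = pathstart ?q"
      using cs closed by (simp_all add: pathfinish_def pathstart_def)
    fix s :: real assume s: "s \<in> {0..1}"
    show "closed_segment (?p s) (?q s) \<subseteq> - {0}"
    proof
      fix z assume "z \<in> closed_segment (?p s) (?q s)"
      then obtain u where u: "0 \<le> u" "u \<le> 1" and z: "z = (1 - u) *\<^sub>R ?p s + u *\<^sub>R ?q s"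
        by (auto simp: in_segment)
      have pos': "(1 - u) * c + u > 0" if "c > 0" for c :: real
        using u that by (cases "u = 0") (auto intro: add_nonneg_pos)
      have "Re z = ((1 - u) * \<alpha> s + u) * cos (\<phi> s)" "Im z = ((1 - u) * \<beta> s + u) * sin (\<phi> s)"
        unfolding z by (simp_all add: algebra_simps)
      moreover have "cos (\<phi> s) \<noteq> 0 \<or> sin (\<phi> s) \<noteq> 0"
        using sin_zero_abs_cos_one[of "\<phi> s"] by fastforce
      ultimately have "Re z \<noteq> 0 \<or> Im z \<noteq> 0"
        using pos'[OF pos(1)[OF s]] pos'[OF pos(2)[OF s]] by auto
      thus "z \<in> - {0}" by auto
    qed
  qed
  hence "winding_number ?p 0 = winding_number ?q 0" by (rule winding_number_homotopic_loops)
  also have "?q = exp \<circ> (\<lambda>s. \<i> * of_real (\<phi> s))" by (simp add: fun_eq_iff cis_conv_exp)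
  also have "winding_number \<dots> 0 = (\<i> * of_real (\<phi> 1) - \<i> * of_real (\<phi> 0)) / (2 * of_real pi * \<i>)"
    by (subst winding_number_compose_exp)
      (auto simp: path_def pathfinish_def pathstart_def intro!: continuous_intros cont)
  also have "\<dots> = (\<phi> 1 - \<phi> 0) / (2 * pi)" by (simp add: field_simps)
  finally show ?thesis .
qed

lemma winding_number_cis:
  fixes \<phi> :: "real \<Rightarrow> real"
  assumes "continuous_on {0..1} \<phi>" "cis (\<phi> 1) = cis (\<phi> 0)"
  shows "winding_number (\<lambda>s. cis (\<phi> s)) 0 = (\<phi> 1 - \<phi> 0) / (2 * pi)"
  using winding_number_cis_deformed[OF assms(1) continuous_on_const continuous_on_const _ _ assms(2), of 1 1]
  by (simp add: cis.code)

context rot_system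
begin

text \<open>The covering of the unit tangent bundle by the space of position and angle
  \<open>(x, y, \<theta>)\<close>.\<close>

definition bpt :: "real \<Rightarrow> real \<Rightarrow> real \<Rightarrow> bundle_point" where
  "bpt x y \<theta> = bundle_proj L ((x, y), (cos \<theta>, sin \<theta> / a x))"

lemma bpt_eq: "bpt x y \<theta> = ((cis (2 * pi * x), cis (2 * pi * y / L)), (cos \<theta>, sin \<theta> / a x))"
  by (simp add: bpt_def bundle_proj_def torus_proj_def)

lemma bpt_in_bundle: "bpt x y \<theta> \<in> unit_bundle L g"
  using unit_vector[of "(x, y)" \<theta>] by (auto simp: bpt_def unit_bundle_def)

lemma bundle_ptE:
  assumes "m \<in> unit_bundle L g" obtains x y \<theta> where "m = bpt x y \<theta>"
proof -
  obtain p v where v: "g p v v = 1" and m: "m = bundle_proj L (p, v)"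
    using assms by (auto simp: unit_bundle_def)
  from v obtain \<theta> where "v = (cos \<theta>, sin \<theta> / a (fst p))" by (rule unit_vector_angle)
  with m that show thesis by (cases p) (auto simp: bpt_def)
qed

lemma fibre_loop_eq:
  "fibre_loop L g (x, y) (cos \<theta>, sin \<theta> / a x) s = bpt x y (\<theta> + 2 * pi * s)"
  using unit_vector[of "(x, y)" \<theta>]
  by (simp add: fibre_loop_def bpt_def perp_g a_nz cos_add sin_add diff_divide_distrib add_divide_distrib algebra_simps)

lemma continuous_on_bpt:
  fixes U :: "'c::t2_space set"
  assumes "continuous_on U x" "continuous_on U y" "continuous_on U \<theta>"
  shows "continuous_on U (\<lambda>s. bpt (x s) (y s) (\<theta> s))"
  unfolding bpt_eq using L_pos
  by (intro continuous_intros assms continuous_on_compose2[OF cont_a assms(1)]) (auto simp: a_nz)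

text \<open>The straight-line homotopy in the coordinates \<open>(x, y, \<theta>)\<close>. Every
  intermediate curve gains exactly \<open>2 * pi\<close> in the angle, so it is closed in the
  bundle.\<close>

lemma homotopic_loops_bpt:
  assumes cont: "continuous_on {0..1} x" "continuous_on {0..1} y" "continuous_on {0..1} \<theta>"
    and closed: "x 1 = x 0" "y 1 = y 0" "\<theta> 1 = \<theta> 0 + 2 * pi"
  shows "homotopic_loops (unit_bundle L g) (\<lambda>s. bpt (x s) (y s) (\<theta> s))
    (fibre_loop L g (x 0, y 0) (cos (\<theta> 0), sin (\<theta> 0) / a (x 0)))"
proof -
  define h where "h p = bpt ((1 - fst p) * x (snd p) + fst p * x 0) ((1 - fst p) * y (snd p) + fst p * y 0)
    ((1 - fst p) * \<theta> (snd p) + fst p * (\<theta> 0 + 2 * pi * snd p))" for p :: "real \<times> real"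
  have c: "continuous_on ({0..1} \<times> {0..1}) (\<lambda>p::real\<times>real. f (snd p))" if "continuous_on {0..1} f" for f :: "real \<Rightarrow> real"
    by (rule continuous_on_compose2[OF that]) (auto intro: continuous_intros)
  have "continuous_on ({0..1} \<times> {0..1}) h"
    unfolding h_def by (intro continuous_on_bpt continuous_intros c cont)
  moreover have "h \<in> {0..1} \<times> {0..1} \<rightarrow> unit_bundle L g"
    by (auto simp: h_def bpt_in_bundle)
  moreover have "pathfinish (h \<circ> Pair u) = pathstart (h \<circ> Pair u)" for u
    using closed
    by (simp add: pathfinish_def pathstart_def h_def) (simp add: bpt_eq algebra_simps sin_add cos_add)
  ultimately show ?thesis unfolding homotopic_loops
    by (intro exI[of _ h]) (auto simp: h_def fibre_loop_eq)
qed

lemma ode_continuous: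
  assumes "ode x y \<theta>"
  shows "continuous_on U (\<lambda>s. x (r * s))" "continuous_on U (\<lambda>s. y (r * s))" "continuous_on U (\<lambda>s. \<theta> (r * s))"
proof -
  have "continuous_on U (\<lambda>s. r * s)" by (intro continuous_intros)
  thus "continuous_on U (\<lambda>s. x (r * s))" "continuous_on U (\<lambda>s. y (r * s))" "continuous_on U (\<lambda>s. \<theta> (r * s))"
    using C_k_ode[OF assms, of 0] by (blast intro: continuous_on_compose2 C_k_on_imp_continuous_on)+
qed

text \<open>The two circle coordinates and the velocity map the bundle continuously into the
  punctured plane. The winding numbers of a loop under these maps are invariant under homotopy, and
  those of an oriented fibre are 0, 0 and 1.\<close>

lemma Lambda_plus_rotation:
  assumes ode: "ode x y \<theta>" and \<Lambda>: "(\<lambda>t. (x t, y t), \<tau>) \<in> Lambda_plus L g"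
  shows "x \<tau> = x 0" "y \<tau> = y 0" "\<theta> \<tau> = \<theta> 0 + 2 * pi"
proof -
  let ?\<gamma> = "\<lambda>t. (x t, y t)"
  define P where "P s = bpt (x (\<tau> * s)) (y (\<tau> * s)) (\<theta> (\<tau> * s))" for s
  obtain q v where v: "g q v v = 1" and hom: "homotopic_loops (unit_bundle L g)
      (\<lambda>s. bundle_proj L (?\<gamma> (\<tau> * s), velocity ?\<gamma> (\<tau> * s))) (fibre_loop L g q v)"
    using \<Lambda> by (auto simp: Lambda_plus_def)
  obtain \<eta> where \<eta>: "v = (cos \<eta>, sin \<eta> / a (fst q))" using unit_vector_angle[OF v] .
  obtain x0 y0 where q: "q = (x0, y0)" by (cases q)
  define Q where "Q s = bpt x0 y0 (\<eta> + 2 * pi * s)" for s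
  have "(\<lambda>s. bundle_proj L (?\<gamma> (\<tau> * s), velocity ?\<gamma> (\<tau> * s))) = P"
    by (simp add: P_def bpt_def fun_eq_iff fun_cong[OF ode_velocity[OF ode]])
  moreover have "fibre_loop L g q v = Q"
    unfolding \<eta> q by (simp add: fun_eq_iff fibre_loop_eq Q_def)
  ultimately have hom: "homotopic_loops (unit_bundle L g) P Q" using hom by simp
  have "pathfinish P = pathstart P" using homotopic_loops_imp_loop[OF hom] by simp
  hence loop: "P 1 = P 0" by (simp add: pathfinish_def pathstart_def)
  have c: "continuous_on U (\<lambda>s. x (\<tau> * s))" "continuous_on U (\<lambda>s. y (\<tau> * s))" "continuous_on U (\<lambda>s. \<theta> (\<tau> * s))" for U
    by (rule ode_continuous[OF ode])+
  have w: "winding_number (h \<circ> P) 0 = winding_number (h \<circ> Q) 0"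
    if "continuous_on (unit_bundle L g) h" "\<And>x y \<theta>. h (bpt x y \<theta>) \<noteq> 0" for h
    by (rule winding_number_homotopic_loops[OF homotopic_loops_continuous_image[OF hom that(1)]])
      (use that(2) in \<open>auto elim!: bundle_ptE\<close>)
  have "winding_number ((\<lambda>m. fst (fst m)) \<circ> P) 0 = (2 * pi * x (\<tau> * 1) - 2 * pi * x (\<tau> * 0)) / (2 * pi)"
    using winding_number_cis[of "\<lambda>s. 2 * pi * x (\<tau> * s)"] loop
    by (simp add: P_def o_def bpt_eq c continuous_intros)
  moreover have "winding_number ((\<lambda>m. fst (fst m)) \<circ> Q) 0 = 0"
    using winding_number_cis[of "\<lambda>s. 2 * pi * x0"] by (simp add: Q_def o_def bpt_eq)
  ultimately have "complex_of_real (x \<tau> - x 0) = 0"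
    using w[of "\<lambda>m. fst (fst m)"] by (simp add: bpt_eq continuous_intros)
  thus x: "x \<tau> = x 0" by (simp only: of_real_eq_0_iff eq_iff_diff_eq_0[symmetric])
  have "winding_number ((\<lambda>m. snd (fst m)) \<circ> P) 0 = (2 * pi * y (\<tau> * 1) / L - 2 * pi * y (\<tau> * 0) / L) / (2 * pi)"
    using winding_number_cis[of "\<lambda>s. 2 * pi * y (\<tau> * s) / L"] loop L_pos
    by (simp add: P_def o_def bpt_eq c continuous_intros)
  moreover have "winding_number ((\<lambda>m. snd (fst m)) \<circ> Q) 0 = 0"
    using winding_number_cis[of "\<lambda>s. 2 * pi * y0 / L"] by (simp add: Q_def o_def bpt_eq)
  ultimately have "complex_of_real ((y \<tau> - y 0) / L) = 0"
    using w[of "\<lambda>m. snd (fst m)"] by (simp add: bpt_eq continuous_intros diff_divide_distrib)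
  hence "(y \<tau> - y 0) / L = 0" by (simp only: of_real_eq_0_iff)
  thus y: "y \<tau> = y 0" using L_pos by simp
  let ?h = "\<lambda>m::bundle_point. Complex (fst (snd m)) (snd (snd m))"
  \<comment> \<open>The second velocity component is \<open>sin \<theta> / a\<close>; the angles can
    be compared because \<open>x\<close>, and with it \<open>a\<close>, has already been shown to
    return.\<close>
  have cis: "cis (\<theta> \<tau>) = cis (\<theta> 0)"
    using loop a_nz[of "x 0"] by (simp add: P_def bpt_eq x complex_eq_iff)
  have "winding_number (?h \<circ> P) 0 = (\<theta> (\<tau> * 1) - \<theta> (\<tau> * 0)) / (2 * pi)"
    using winding_number_cis_deformed[of "\<lambda>s. \<theta> (\<tau> * s)" "\<lambda>s. 1" "\<lambda>s. 1 / a (x (\<tau> * s))"] cis x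
    by (simp add: P_def o_def bpt_eq c continuous_intros a_pos a_nz continuous_on_compose2[OF cont_a c(1)])
  moreover have "winding_number (?h \<circ> Q) 0 = 1"
    using winding_number_cis_deformed[of "\<lambda>s. \<eta> + 2 * pi * s" "\<lambda>s. 1" "\<lambda>s. 1 / a x0"]
    by (simp add: Q_def o_def bpt_eq continuous_intros a_pos cis_mult[symmetric])
  moreover have "?h (bpt x y \<theta>) \<noteq> 0" for x y \<theta>
    using sin_zero_abs_cos_one[of \<theta>] a_nz[of x] by (auto simp: bpt_eq complex_eq_iff)
  ultimately have "complex_of_real ((\<theta> \<tau> - \<theta> 0) / (2 * pi)) = of_real 1"
    using w[of ?h] by (simp add: Complex_eq continuous_intros)
  hence "(\<theta> \<tau> - \<theta> 0) / (2 * pi) = 1" by (simp only: of_real_eq_iff)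
  thus "\<theta> \<tau> = \<theta> 0 + 2 * pi" by (simp add: field_simps)
qed

text \<open>Advancing the time by \<open>T I (2 * pi)\<close> advances the angle by one turn, by
  \<open>T_2pi\<close> and injectivity of \<open>T I\<close>. Then \<open>x\<close> returns because
  \<open>X\<close> is periodic in the angle, and \<open>y\<close> returns because the displacement
  vanishes.\<close>

lemma ode_periodic:
  assumes ode: "ode x y \<theta>" and I: "I = H (x 0) (\<theta> 0)" and G0: "G (I, 2 * pi) = 0"
    and \<tau>: "\<tau> = T I (2 * pi)"
  shows "\<theta> (t + \<tau>) = \<theta> t + 2 * pi" "x (t + \<tau>) = x t" "y (t + \<tau>) = y t"
proof -
  note S = ode_solution[OF ode I]
  have "T I (\<theta> (t + \<tau>)) = T I (\<theta> t + 2 * pi)" 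
    unfolding T_2pi using S(3)[of "t + \<tau>"] S(3)[of t] \<tau> by linarith
  thus t: "\<theta> (t + \<tau>) = \<theta> t + 2 * pi" by (simp add: T_inj)
  show "x (t + \<tau>) = x t" by (simp add: S(1)[of "t + \<tau>"] S(1)[of t] t X_2pi)
  show "y (t + \<tau>) = y t" using G_2pi[of I "\<theta> t"] by (simp add: S(2)[of "t + \<tau>"] S(2)[of t] t G0)
qed

lemma closed_geodesic_exists:
  assumes G0: "G (I, 2 * pi) = 0"
  obtains c where "c \<in> Lambda_plus_geodesics L g B" "magnetic_length g B c = J I"
proof -
  \<comment> \<open>Starting with angle 0 at \<open>X (I, 0)\<close> puts the solution on the level
    \<open>I\<close>; by translation invariance the value of \<open>y\<close> is immaterial.\<close>
  obtain x y \<theta> where ode: "ode x y \<theta>" and ini: "x 0 = X (I, 0)" "y 0 = 0" "\<theta> 0 = 0"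
    by (rule ode_exists)
  define \<tau> where "\<tau> = T I (2 * pi)"
  have \<tau>: "\<tau> > 0" by (simp add: \<tau>_def T_2pi_pos)
  have I: "I = H (x 0) (\<theta> 0)" by (simp add: ini H_X)
  note per = ode_periodic[OF ode I G0 \<tau>_def]
  let ?\<gamma> = "\<lambda>t. (x t, y t)"
  have rot: "\<theta> \<tau> = \<theta> 0 + 2 * pi" using per(1)[of 0] by simp
  have c: "continuous_on U (\<lambda>s. x (\<tau> * s))" "continuous_on U (\<lambda>s. y (\<tau> * s))" "continuous_on U (\<lambda>s. \<theta> (\<tau> * s))" for U
    by (rule ode_continuous[OF ode])+
  have "homotopic_loops (unit_bundle L g) (\<lambda>s. bpt (x (\<tau> * s)) (y (\<tau> * s)) (\<theta> (\<tau> * s)))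
      (fibre_loop L g (x (\<tau> * 0), y (\<tau> * 0)) (cos (\<theta> (\<tau> * 0)), sin (\<theta> (\<tau> * 0)) / a (x (\<tau> * 0))))"
    by (rule homotopic_loops_bpt[OF c]) (use per[of 0] in auto)
  also have "(\<lambda>s. bpt (x (\<tau> * s)) (y (\<tau> * s)) (\<theta> (\<tau> * s))) =
      (\<lambda>s. bundle_proj L (?\<gamma> (\<tau> * s), velocity ?\<gamma> (\<tau> * s)))"
    by (simp add: bpt_def fun_eq_iff fun_cong[OF ode_velocity[OF ode]])
  finally have "\<exists>q v. g q v v = 1 \<and> homotopic_loops (unit_bundle L g)
      (\<lambda>s. bundle_proj L (?\<gamma> (\<tau> * s), velocity ?\<gamma> (\<tau> * s))) (fibre_loop L g q v)"
    using unit_vector[of "(x (\<tau> * 0), y (\<tau> * 0))" "\<theta> (\<tau> * 0)", unfolded fst_conv] by blast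
  hence "(?\<gamma>, \<tau>) \<in> Lambda_plus_geodesics L g B"
    using smooth_curve[OF ode] \<tau> per ode_imp_geodesic[OF ode]
    by (simp add: Lambda_plus_geodesics_def Lambda_plus_def smooth_on_UNIV_iff)
  moreover have "magnetic_length g B (?\<gamma>, \<tau>) = J I"
    using magnetic_length_closed[OF ode \<tau> per(2,3) rot] I by simp
  ultimately show thesis using that by blast
qed

text \<open>Membership in \<open>Lambda_plus\<close> gives periodicity of the projection only. The
  rotation lemma closes the lift after one turn, which forces \<open>G (I, 2 * pi) = 0\<close> and
  \<open>\<tau> = T I (2 * pi)\<close>; the lifted curve is therefore periodic.\<close>

lemma closed_geodesic_length:
  assumes "c \<in> Lambda_plus_geodesics L g B"
  obtains I where "magnetic_length g B c = J I"
proof -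
  obtain \<gamma> \<tau> where c: "c = (\<gamma>, \<tau>)" by (cases c)
  have geo: "magnetic_geodesic g B \<gamma>" and \<Lambda>: "(\<gamma>, \<tau>) \<in> Lambda_plus L g" and \<tau>: "\<tau> > 0"
    using assms by (auto simp: c Lambda_plus_geodesics_def Lambda_plus_def)
  have "g (\<gamma> 0) (velocity \<gamma> 0) (velocity \<gamma> 0) = 1" using geo by (simp add: magnetic_geodesic_def)
  then obtain \<theta>0 where "velocity \<gamma> 0 = (cos \<theta>0, sin \<theta>0 / a (fst (\<gamma> 0)))" by (rule unit_vector_angle)
  from geodesic_imp_ode[OF geo this] obtain \<theta> where
    "ode (\<lambda>t. fst (\<gamma> t)) (\<lambda>t. snd (\<gamma> t)) \<theta>" by blast
  moreover define x y where "x = (\<lambda>t. fst (\<gamma> t))" and "y = (\<lambda>t. snd (\<gamma> t))"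
  ultimately have ode: "ode x y \<theta>" and \<gamma>: "\<gamma> = (\<lambda>t. (x t, y t))" by simp_all
  note rot = Lambda_plus_rotation[OF ode \<Lambda>[unfolded \<gamma>]]
  define I where "I = H (x 0) (\<theta> 0)"
  note S = ode_solution[OF ode I_def]
  have "G (I, 2 * pi) = 0" using S(2)[of \<tau>] rot(2) by (simp add: rot(3) G_2pi)
  moreover have "\<tau> = T I (2 * pi)" using S(3)[of \<tau>] by (simp add: rot(3) T_2pi)
  ultimately have per: "x (t + \<tau>) = x t" "y (t + \<tau>) = y t" for t
    using ode_periodic(2,3)[OF ode I_def] by blast+
  have "magnetic_length g B c = J I"
    unfolding c \<gamma> I_def by (rule magnetic_length_closed[OF ode \<tau> per rot(3)])
  thus thesis by (rule that)
qed

end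

section \<open>Zoll systems\<close>

lemma cis_eq_iff_int: "cis u = cis v \<longleftrightarrow> (\<exists>n::int. u = v + 2 * pi * of_int n)"
  using sin_cos_eq_iff[of u v] by (auto simp: complex_eq_iff)

context rot_system
begin

lemma a_per_int: "a (x + of_int n) = a x"
proof (induction n rule: int_induct[of _ 0])
  case (step1 n)
  then show ?case using a_per[of "x + of_int n"] by (simp add: algebra_simps)
next
  case (step2 n)
  then show ?case using a_per[of "x + of_int (n - 1)"] by (simp add: algebra_simps)
qed simp

lemma bpt_eq_iff:
  "bpt x' y' \<theta>' = bpt x y \<theta> \<longleftrightarrow>
    (\<exists>m n k::int. x' = x + of_int m \<and> y' = y + L * of_int n \<and> \<theta>' = \<theta> + 2 * pi * of_int k)"
proof
  assume e: "bpt x' y' \<theta>' = bpt x y \<theta>"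
  then obtain m :: int where "2 * pi * x' = 2 * pi * x + 2 * pi * of_int m"
    by (auto simp: bpt_eq cis_eq_iff_int)
  hence "2 * pi * x' = 2 * pi * (x + of_int m)" by (simp add: algebra_simps)
  hence m: "x' = x + of_int m" by simp
  obtain n :: int where "2 * pi * y' / L = 2 * pi * y / L + 2 * pi * of_int n"
    using e by (auto simp: bpt_eq cis_eq_iff_int)
  hence "2 * pi * y' = 2 * pi * (y + L * of_int n)" using L_pos by (simp add: field_simps)
  hence n: "y' = y + L * of_int n" by simp
  have "cis \<theta>' = cis \<theta>" using e a_nz[of x] by (simp add: bpt_eq m a_per_int complex_eq_iff)
  with m n show "\<exists>m n k::int. x' = x + of_int m \<and> y' = y + L * of_int n \<and> \<theta>' = \<theta> + 2 * pi * of_int k"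
    by (auto simp: cis_eq_iff_int)
next
  assume "\<exists>m n k::int. x' = x + of_int m \<and> y' = y + L * of_int n \<and> \<theta>' = \<theta> + 2 * pi * of_int k"
  then obtain m n k :: int where
    e: "x' = x + of_int m" "y' = y + L * of_int n" "\<theta>' = \<theta> + 2 * pi * of_int k" by blast
  have "cis (2 * pi * x') = cis (2 * pi * x)" "cis (2 * pi * y' / L) = cis (2 * pi * y / L)"
    unfolding cis_eq_iff_int using L_pos by (auto simp: e field_simps)
  moreover have "cos \<theta>' = cos \<theta> \<and> sin \<theta>' = sin \<theta>"
    using sin_cos_eq_iff[of \<theta>' \<theta>] e(3) by blast
  ultimately show "bpt x' y' \<theta>' = bpt x y \<theta>" by (simp add: bpt_eq e(1) a_per_int)
qed

lemma G_2pi_int: "G (I, \<theta> + 2 * pi * of_int k) = G (I, \<theta>) + of_int k * G (I, 2 * pi)"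
proof (induction k rule: int_induct[of _ 0])
  case (step1 k)
  then show ?case using G_2pi[of I "\<theta> + 2 * pi * of_int k"] by (simp add: algebra_simps)
next
  case (step2 k)
  then show ?case using G_2pi[of I "\<theta> + 2 * pi * of_int (k - 1)"] by (simp add: algebra_simps)
qed simp

lemma ode_strict_mono:
  assumes "ode x y \<theta>" shows "strict_mono \<theta>"
proof
  fix s t :: real assume "s < t"
  hence "T (H (x 0) (\<theta> 0)) (\<theta> s) < T (H (x 0) (\<theta> 0)) (\<theta> t)"
    using ode_solution(3)[OF assms refl, of s] ode_solution(3)[OF assms refl, of t] by simp
  thus "\<theta> s < \<theta> t" by (metis T_less less_asym' linorder_neqE_linordered_idom order_less_irrefl)
qed

lemma zoll_imp_closed:
  assumes zoll: "zoll L g B"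
  shows "G (I, 2 * pi) = 0"
proof -
  have rat: "\<exists>k n::int. k \<noteq> 0 \<and> of_int k * G (I, 2 * pi) = L * of_int n" for I
  proof -
    obtain x y \<theta> where ode: "ode x y \<theta>" and ini: "x 0 = X (I, 0)" "y 0 = 0" "\<theta> 0 = 0"
      by (rule ode_exists)
    have I: "I = H (x 0) (\<theta> 0)" by (simp add: ini H_X)
    let ?q = "(x 0, y 0)" and ?v = "(cos (\<theta> 0), sin (\<theta> 0) / a (x 0))"
    have "g ?q ?v ?v = 1" using unit_vector[of ?q "\<theta> 0"] by simp
    then obtain \<rho> and \<tau> :: "real \<Rightarrow> real" where \<tau>: "strict_mono \<tau>" "surj \<tau>"
      and \<rho>: "\<And>t. bundle_proj L (magnetic_flow g B t (?q, ?v)) = \<rho> (cis (\<tau> t)) (bundle_proj L (?q, ?v))"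
      using zoll unfolding zoll_def by meson
    have flow: "bundle_proj L (magnetic_flow g B t (?q, ?v)) = bpt (x t) (y t) (\<theta> t)" for t
      unfolding magnetic_flow_ode[OF ode] bpt_def ..
    \<comment> \<open>The time at which the action has gone once round the circle; it exists because
      \<tau> is onto, and it is positive because \<tau> increases.\<close>
    obtain t where t: "\<tau> t = \<tau> 0 + 2 * pi" using \<tau>(2) by (metis surj_def)
    hence "\<tau> 0 < \<tau> t" by simp
    hence "0 < t" using \<tau>(1) by (simp add: strict_mono_less)
    have "cis (\<tau> t) = cis (\<tau> 0)" unfolding t by (simp add: cis_mult[symmetric])
    hence "bpt (x t) (y t) (\<theta> t) = bpt (x 0) (y 0) (\<theta> 0)"
      using \<rho>[of t] \<rho>[of 0] flow by simp
    then obtain n k :: int where n: "y t = y 0 + L * of_int n" and k: "\<theta> t = \<theta> 0 + 2 * pi * of_int k"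
      by (auto simp: bpt_eq_iff)
    \<comment> \<open>The angle has strictly increased, so the return to the same point involves a
      nonzero number of turns.\<close>
    have "\<theta> 0 < \<theta> t" using ode_strict_mono[OF ode] \<open>0 < t\<close> by (simp add: strict_mono_less)
    hence "k \<noteq> 0" using k by auto
    moreover have "of_int k * G (I, 2 * pi) = L * of_int n"
      using ode_solution(2)[OF ode I, of t] n by (simp add: k G_2pi_int)
    ultimately show ?thesis by blast
  qed
  \<comment> \<open>All displacements are rational multiples of \<open>L\<close>, hence form a
    countable set; a connected set of reals with more than one point is uncountable.\<close>
  have "range (\<lambda>I. G (I, 2 * pi)) \<subseteq> (\<lambda>(k::int, n::int). L * of_int n / of_int k) ` UNIV"
  proof clarify
    fix I
    obtain k n :: int where "k \<noteq> 0" "of_int k * G (I, 2 * pi) = L * of_int n" using rat by blast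
    hence "G (I, 2 * pi) = L * of_int n / of_int k" by (simp add: field_simps)
    thus "G (I, 2 * pi) \<in> (\<lambda>(k::int, n::int). L * of_int n / of_int k) ` UNIV" by force
  qed
  hence "countable (range (\<lambda>I. G (I, 2 * pi)))" by (rule countable_subset) simp
  moreover have "connected (range (\<lambda>I. G (I, 2 * pi)))"
    by (intro connected_continuous_image connected_UNIV continuous_on_slice C_k_on_imp_continuous_on[OF C_k_G])
  ultimately have const: "G (I, 2 * pi) = G (0, 2 * pi)" for I
    using connected_uncountable by blast
  \<comment> \<open>\<open>J\<close> has constant derivative, so it is affine; its equal values at 0
    and \<open>A\<close> make the slope 0.\<close>
  have "((\<lambda>I. G (0, 2 * pi) * I) has_real_derivative G (I, 2 * pi)) (at I)" for I
    unfolding const[of I] by (auto intro!: derivative_eq_intros)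
  from DERIV_eq_diff_const[OF DERIV_J this, of A 0]
  have "G (0, 2 * pi) * A = 0" using J_per[of 0] by simp
  thus ?thesis using A_pos const by simp
qed

text \<open>Rotating the velocity angle by \<open>\<phi>\<close> along the geodesic. When all geodesics close up after one
  turn, this is the circle action.\<close>

definition turn :: "real \<Rightarrow> real \<Rightarrow> real \<Rightarrow> real \<Rightarrow> bundle_point" where
  "turn \<phi> x y \<theta> = bpt (X (H x \<theta>, \<theta> + \<phi>)) (y + G (H x \<theta>, \<theta> + \<phi>) - G (H x \<theta>, \<theta>)) (\<theta> + \<phi>)"

text \<open>Works with arbitrarily chosen coordinates of \<open>m\<close> and the principal argument
  of \<open>z\<close>. Independence of these choices, under vanishing displacements, is
  \<open>turn_cong\<close>.\<close>

definition circle_act :: "complex \<Rightarrow> bundle_point \<Rightarrow> bundle_point" where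
  "circle_act z m = (let (x, y, \<theta>) = SOME (x, y, \<theta>). m = bpt x y \<theta> in turn (Arg z) x y \<theta>)"

lemma H_per_int: "H (x + of_int m) (\<theta> + 2 * pi * of_int k) = H x \<theta> + of_int m * A"
proof -
  have "sin (\<theta> + 2 * pi * of_int k) = sin \<theta>"
    using sin_cos_eq_iff[of "\<theta> + 2 * pi * of_int k" \<theta>] by blast
  moreover have "F (x + of_int m) = F x + of_int m * A"
  proof (induction m rule: int_induct[of _ 0])
    case (step1 m)
    then show ?case using F_per[of "x + of_int m"] by (simp add: algebra_simps)
  next
    case (step2 m)
    then show ?case using F_per[of "x + of_int (m - 1)"] by (simp add: algebra_simps)
  qed simp
  ultimately show ?thesis by (simp add: H_def a_per_int)
qed

lemma X_per_int: "X (I + of_int m * A, \<theta> + 2 * pi * of_int k) = X (I, \<theta>) + of_int m"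
  by (rule X_eqI) (simp add: H_per_int H_X)

lemma G_per_int: "G (I + of_int m * A, \<theta>) = G (I, \<theta>)"
proof (induction m rule: int_induct[of _ 0])
  case (step1 m)
  then show ?case using G_per[of "I + of_int m * A"] by (simp add: algebra_simps)
next
  case (step2 m)
  then show ?case using G_per[of "I + of_int (m - 1) * A"] by (simp add: algebra_simps)
qed simp

context
  assumes G_closed: "\<And>I. G (I, 2 * pi) = 0"
begin

text \<open>Other coordinates of the same point shift the level by a multiple of \<open>A\<close>
  and the angles by multiples of \<open>2 * pi\<close>. Then \<open>X\<close> changes by an integer,
  and \<open>G\<close> is unchanged: under the shift of level by periodicity, under the shifts of
  angle because the displacements vanish.\<close>

lemma turn_cong:
  assumes "bpt x' y' \<theta>' = bpt x y \<theta>" "cis \<phi>' = cis \<phi>"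
  shows "turn \<phi>' x' y' \<theta>' = turn \<phi> x y \<theta>"
proof -
  obtain m n k :: int where
    e: "x' = x + of_int m" "y' = y + L * of_int n" "\<theta>' = \<theta> + 2 * pi * of_int k"
    using assms(1) by (auto simp: bpt_eq_iff)
  obtain j :: int where j: "\<phi>' = \<phi> + 2 * pi * of_int j" using assms(2) by (auto simp: cis_eq_iff_int)
  have s: "\<theta>' + \<phi>' = \<theta> + \<phi> + 2 * pi * of_int (k + j)" by (simp add: e j algebra_simps)
  have H: "H x' \<theta>' = H x \<theta> + of_int m * A" unfolding e by (rule H_per_int)
  have G: "G (H x' \<theta>', \<theta>' + \<phi>') = G (H x \<theta>, \<theta> + \<phi>)" "G (H x' \<theta>', \<theta>') = G (H x \<theta>, \<theta>)"
    unfolding s H G_per_int by (simp_all add: G_2pi_int G_closed e del: of_int_add)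
  show ?thesis
    unfolding turn_def bpt_eq_iff G unfolding s H X_per_int e(2)
    by (intro exI[of _ m] exI[of _ n] exI[of _ "k + j"]) simp
qed

lemma circle_act_cis: "circle_act (cis \<phi>) (bpt x y \<theta>) = turn \<phi> x y \<theta>"
proof -
  obtain x' y' \<theta>' where s: "(SOME (x', y', \<theta>'). bpt x y \<theta> = bpt x' y' \<theta>') = (x', y', \<theta>')"
    by (metis prod_cases3)
  have "\<exists>p. case p of (x', y', \<theta>') \<Rightarrow> bpt x y \<theta> = bpt x' y' \<theta>'" by (rule exI[of _ "(x, y, \<theta>)"]) simp
  from someI_ex[OF this] have "bpt x' y' \<theta>' = bpt x y \<theta>" unfolding s by simp
  moreover have "cis (Arg (cis \<phi>)) = cis \<phi>" by (simp add: cis_Arg)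
  ultimately have "turn (Arg (cis \<phi>)) x' y' \<theta>' = turn \<phi> x y \<theta>" by (rule turn_cong)
  thus ?thesis by (simp add: circle_act_def s)
qed

lemma turn_add:
  "circle_act (cis \<psi>) (turn \<phi> x y \<theta>) = turn (\<phi> + \<psi>) x y \<theta>"
  unfolding turn_def[of \<phi>] circle_act_cis unfolding turn_def H_X by (simp add: algebra_simps)

end

end

section \<open>Local branches of the angle and smoothness of the circle action\<close>

definition angle_lift :: "real \<Rightarrow> real \<Rightarrow> real \<Rightarrow> real" where
  "angle_lift c u v = c + arctan ((v * cos c - u * sin c) / (u * cos c + v * sin c))"

text \<open>\<open>angle_lift c\<close> is the branch of the argument within \<open>pi / 2\<close>
  of \<open>c\<close>: rotating \<open>(u, v)\<close> by \<open>- c\<close> gives the coordinates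
  \<open>p > 0\<close> and \<open>q\<close>, and \<open>arctan (q / p)\<close> is the remaining
  angle. The formula makes sense on the whole open half-plane, so it extends smoothly off the
  circle.\<close>

lemma angle_lift:
  assumes "u\<^sup>2 + v\<^sup>2 = 1" "u * cos c + v * sin c > 0"
  shows "cos (angle_lift c u v) = u" "sin (angle_lift c u v) = v"
proof -
  define p q where "p = u * cos c + v * sin c" and "q = v * cos c - u * sin c"
  have cs: "cos c * cos c = 1 - sin c * sin c"
    using sin_cos_squared_add[of c] by (simp add: power2_eq_square algebra_simps)
  have "p\<^sup>2 + q\<^sup>2 = (u\<^sup>2 + v\<^sup>2) * ((sin c)\<^sup>2 + (cos c)\<^sup>2)"
    unfolding p_def q_def by algebra
  hence "p\<^sup>2 + q\<^sup>2 = 1" by (simp add: assms(1))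
  hence "1 + (q / p)\<^sup>2 = (1 / p)\<^sup>2" using assms(2) by (simp add: p_def[symmetric] power_divide field_simps)
  hence "sqrt (1 + (q / p)\<^sup>2) = 1 / p" using assms(2) by (simp add: p_def[symmetric] real_sqrt_unique)
  hence 1: "cos (arctan (q / p)) = p" "sin (arctan (q / p)) = q"
    using assms(2) by (simp_all add: cos_arctan sin_arctan p_def[symmetric])
  have "cos (angle_lift c u v) = cos c * p - sin c * q" "sin (angle_lift c u v) = sin c * p + cos c * q"
    unfolding angle_lift_def p_def[symmetric] q_def[symmetric] cos_add sin_add 1 by simp_all
  moreover have "cos c * p - sin c * q = u * (cos c * cos c + sin c * sin c)"
    "sin c * p + cos c * q = v * (cos c * cos c + sin c * sin c)"
    unfolding p_def q_def by algebra+
  ultimately show "cos (angle_lift c u v) = u" "sin (angle_lift c u v) = v" by (simp_all add: cs)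
qed

lemma C_k_angle_lift:
  assumes "open U" "C_k_on k U u" "C_k_on k U v" "\<And>q. q \<in> U \<Longrightarrow> u q * cos c + v q * sin c > 0"
  shows "C_k_on k U (\<lambda>q. angle_lift c (u q) (v q))"
  unfolding angle_lift_def
  by (intro C_k_on_add C_k_on_const C_k_on_comp_UNIV[OF _ C_k_on_arctan] C_k_on_divide C_k_on_mult C_k_on_diff assms)
    (use assms(4) in \<open>auto simp: less_le\<close>)

lemma C_k_cis:
  assumes "open U" "C_k_on k U f"
  shows "C_k_on k U (\<lambda>q. cis (f q))"
proof -
  have "C_k_on k U (\<lambda>q. cos (f q) *\<^sub>R (1::complex) + sin (f q) *\<^sub>R \<i>)"
    by (intro C_k_intros assms)
  thus ?thesis by (simp add: cis.ctr Complex_eq scaleR_conv_of_real mult.commute)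
qed

context rot_system
begin

lemma C_k_turn:
  assumes U: "open U" and C: "C_k_on k U \<phi>" "C_k_on k U x" "C_k_on k U y" "C_k_on k U \<theta>"
  shows "C_k_on k U (\<lambda>q. turn (\<phi> q) (x q) (y q) (\<theta> q))"
  unfolding turn_def bpt_eq H_def using L_pos
  by (intro C_k_on_Pair C_k_cis C_k_on_divide C_k_intros C_k_a C_k_on_comp_UNIV[OF _ C_k_X]
      C_k_on_comp_UNIV[OF _ C_k_F] C_k_on_comp_UNIV[OF _ C_k_G] assms) (auto simp: a_nz)

context
  assumes G_closed: "\<And>I. G (I, 2 * pi) = 0"
begin

text \<open>Near a given point, \<open>angle_lift\<close> recovers \<phi>, \<open>x\<close>,
  \<open>y\<close> and \<theta> smoothly from the ambient coordinates, also off the bundle.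
  Inserting them into \<open>turn\<close> gives the required local extension. On the bundle these
  coordinates may differ from other ones by periods, which \<open>circle_act_cis\<close>
  tolerates.\<close>

lemma smooth_circle_act: "smooth_on (sphere 0 1 \<times> unit_bundle L g) (\<lambda>(z, m). circle_act z m)"
  unfolding smooth_on_def
proof
  fix q0 :: "complex \<times> bundle_point" assume "q0 \<in> sphere 0 1 \<times> unit_bundle L g"
  then obtain z0 m0 where q0: "q0 = (z0, m0)" "norm z0 = 1" "m0 \<in> unit_bundle L g" by auto
  obtain x0 y0 \<theta>0 where m0: "m0 = bpt x0 y0 \<theta>0" using bundle_ptE[OF q0(3)] .
  define \<phi>0 where "\<phi>0 = Arg z0"
  have z0: "z0 = cis \<phi>0" using q0(2) by (metis \<phi>0_def cis_Arg norm_zero sgn_div_norm div_by_1 scaleR_one inverse_1 zero_neq_one)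
  define r1 r2 where "r1 = 2 * pi * x0" and "r2 = 2 * pi * y0 / L"
  let ?C = "\<lambda>q::complex \<times> bundle_point. fst (fst (snd q))" and ?D = "\<lambda>q::complex \<times> bundle_point. snd (fst (snd q))"
  let ?v1 = "\<lambda>q::complex \<times> bundle_point. fst (snd (snd q))" and ?v2 = "\<lambda>q::complex \<times> bundle_point. snd (snd (snd q))"
  define U0 :: "(complex \<times> bundle_point) set" where "U0 = {q. Re (fst q) * cos \<phi>0 + Im (fst q) * sin \<phi>0 > 0} \<inter>
    {q. Re (?C q) * cos r1 + Im (?C q) * sin r1 > 0} \<inter> {q. Re (?D q) * cos r2 + Im (?D q) * sin r2 > 0}"
  have U0: "open U0"
    unfolding U0_def by (intro open_Int open_Collect_less continuous_intros)
  define \<phi> x y where "\<phi> q = angle_lift \<phi>0 (Re (fst q)) (Im (fst q))"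
    and "x q = angle_lift r1 (Re (?C q)) (Im (?C q)) / (2 * pi)"
    and "y q = angle_lift r2 (Re (?D q)) (Im (?D q)) * L / (2 * pi)" for q :: "complex \<times> bundle_point"
  note lin = C_k_on_linear_comp[OF _ bounded_linear_Re] C_k_on_linear_comp[OF _ bounded_linear_Im]
  have C\<phi>: "C_k_on k U0 \<phi>" and Cx: "C_k_on k U0 x" and Cy: "C_k_on k U0 y" for k
    unfolding \<phi>_def x_def y_def
    by (intro C_k_on_divide C_k_on_mult C_k_angle_lift lin C_k_on_fst C_k_on_snd C_k_on_id C_k_on_const U0;
        simp add: U0_def)+
  \<comment> \<open>A second restriction is needed because the angle of the velocity is read from
    \<open>(v1, a(x) * v2)\<close>, where \<open>x\<close> is already a function of the ambient
    point and is known to be smooth on \<open>U0\<close>.\<close>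
  define U where "U = U0 \<inter> (\<lambda>q. ?v1 q * cos \<theta>0 + a (x q) * ?v2 q * sin \<theta>0) -` {0<..}"
  have U: "open U" unfolding U_def
    by (intro continuous_open_preimage U0 continuous_intros continuous_on_compose2[OF cont_a]
        C_k_on_imp_continuous_on[OF Cx]) auto
  define \<theta> where "\<theta> q = angle_lift \<theta>0 (?v1 q) (a (x q) * ?v2 q)" for q
  have C: "C_k_on k U \<phi>" "C_k_on k U x" "C_k_on k U y" for k
    using C\<phi> Cx Cy U U0 by (auto intro: C_k_on_subset simp: U_def)
  have C\<theta>: "C_k_on k U \<theta>" for k
    unfolding \<theta>_def
    by (intro C_k_angle_lift C_k_on_mult C_k_a C C_k_on_fst C_k_on_snd C_k_on_id U) (auto simp: U_def)
  have eq: "cis (\<phi> (z, m)) = z \<and> bpt (x (z, m)) (y (z, m)) (\<theta> (z, m)) = m"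
    if zm: "norm z = 1" "m \<in> unit_bundle L g" "(z, m) \<in> U" for z m
  proof -
    have lift: "cis (angle_lift c (Re w) (Im w)) = w"
      if "norm w = 1" "Re w * cos c + Im w * sin c > 0" for c w
      using angle_lift[of "Re w" "Im w" c] that cmod_power2[of w] by (simp add: complex_eq_iff)
    obtain x1 y1 \<theta>1 where m: "m = bpt x1 y1 \<theta>1" using bundle_ptE[OF zm(2)] .
    have x: "cis (2 * pi * x (z, m)) = cis (2 * pi * x1)"
      using zm lift[of "cis (2 * pi * x1)" r1] by (simp add: x_def m bpt_eq U_def U0_def)
    have y: "cis (2 * pi * y (z, m) / L) = cis (2 * pi * y1 / L)"
      using zm lift[of "cis (2 * pi * y1 / L)" r2] L_pos by (simp add: y_def m bpt_eq U_def U0_def)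
    obtain n :: int where "2 * pi * x (z, m) = 2 * pi * x1 + 2 * pi * of_int n"
      using x by (auto simp: cis_eq_iff_int)
    hence "2 * pi * x (z, m) = 2 * pi * (x1 + of_int n)" by (simp add: algebra_simps)
    hence "x (z, m) = x1 + of_int n" by simp
    hence ax: "a (x (z, m)) = a x1" by (simp add: a_per_int)
    have "cos (\<theta> (z, m)) = cos \<theta>1" "sin (\<theta> (z, m)) = sin \<theta>1"
      using angle_lift[of "cos \<theta>1" "sin \<theta>1" \<theta>0] zm(3) a_nz[of x1]
      by (simp_all add: \<theta>_def U_def ax) (simp_all add: m bpt_eq)
    hence "bpt (x (z, m)) (y (z, m)) (\<theta> (z, m)) = bpt x1 y1 \<theta>1"
      using x y by (simp only: bpt_eq ax)
    hence "bpt (x (z, m)) (y (z, m)) (\<theta> (z, m)) = m" by (simp only: m)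
    moreover have "cis (\<phi> (z, m)) = z"
      using lift[of z \<phi>0] zm by (simp add: \<phi>_def U_def U0_def)
    ultimately show ?thesis by blast
  qed
  have "q0 \<in> U"
  proof -
    have one: "cos c * cos c + sin c * sin c = 1" for c :: real
      using sin_cos_squared_add[of c] by (simp add: power2_eq_square)
    have x: "x q0 = x0" by (simp add: x_def q0(1) m0 bpt_eq angle_lift_def r1_def mult.commute one)
    show ?thesis using a_nz[of x0]
      by (simp add: U_def x) (simp add: U0_def q0(1) m0 z0 bpt_eq r1_def r2_def one)
  qed
  moreover have "turn (\<phi> q) (x q) (y q) (\<theta> q) = (case q of (z, m) \<Rightarrow> circle_act z m)"
    if "q \<in> (sphere 0 1 \<times> unit_bundle L g) \<inter> U" for q
    using that eq circle_act_cis[OF G_closed] by (cases q) (metis (no_types, lifting) IntD1 IntD2 case_prod_conv mem_Sigma_iff mem_sphere_0)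
  moreover have "\<forall>k. C_k_on k U (\<lambda>q. turn (\<phi> q) (x q) (y q) (\<theta> q))"
    by (intro allI C_k_turn U C C\<theta>)
  ultimately show "\<exists>U h. open U \<and> q0 \<in> U \<and> (\<forall>k. C_k_on k U h) \<and>
      (\<forall>q\<in>(sphere 0 1 \<times> unit_bundle L g) \<inter> U. h q = (case q of (z, m) \<Rightarrow> circle_act z m))"
    using U by blast
qed

text \<open>Freeness holds because turning by \<phi> adds \<phi> to the velocity angle: a fixed
  point forces \<phi> to be a multiple of \<open>2 * pi\<close>.\<close>

lemma circle_action: "smooth_free_circle_action (unit_bundle L g) circle_act"
proof -
  have cisE: "\<exists>\<phi>. z = cis \<phi>" if "z \<in> sphere 0 1" for z :: complex
    using that by (metis cis_Arg mem_sphere_0 norm_zero sgn_div_norm div_by_1 scaleR_one inverse_1 zero_neq_one)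
  have 1: "circle_act z m \<in> unit_bundle L g" if z: "z \<in> sphere 0 1" and m: "m \<in> unit_bundle L g" for z m
  proof -
    obtain \<phi> x y \<theta> where "z = cis \<phi>" "m = bpt x y \<theta>" using cisE[OF z] bundle_ptE[OF m] by metis
    thus ?thesis by (simp add: circle_act_cis[OF G_closed] turn_def bpt_in_bundle)
  qed
  have 2: "circle_act 1 m = m" if m: "m \<in> unit_bundle L g" for m
  proof -
    obtain x y \<theta> where "m = bpt x y \<theta>" using bundle_ptE[OF m] .
    thus ?thesis using circle_act_cis[OF G_closed, of 0] by (simp add: turn_def X_H)
  qed
  have 3: "circle_act (z * w) m = circle_act z (circle_act w m)"
    if z: "z \<in> sphere 0 1" and w: "w \<in> sphere 0 1" and m: "m \<in> unit_bundle L g" for z w m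
  proof -
    obtain \<phi> \<psi> x y \<theta> where e: "z = cis \<phi>" "w = cis \<psi>" "m = bpt x y \<theta>"
      using cisE[OF z] cisE[OF w] bundle_ptE[OF m] by metis
    show ?thesis unfolding e cis_mult circle_act_cis[OF G_closed] turn_add[OF G_closed] by (simp add: add.commute)
  qed
  have 4: "z = 1" if z: "z \<in> sphere 0 1" and m: "m \<in> unit_bundle L g" and fixed: "circle_act z m = m" for z m
  proof -
    obtain \<phi> x y \<theta> where e: "z = cis \<phi>" "m = bpt x y \<theta>" using cisE[OF z] bundle_ptE[OF m] by metis
    have "turn \<phi> x y \<theta> = bpt x y \<theta>" using fixed by (simp add: e circle_act_cis[OF G_closed])
    then obtain k :: int where "\<theta> + \<phi> = \<theta> + 2 * pi * of_int k"
      unfolding turn_def bpt_eq_iff by blast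
    hence "cis \<phi> = cis 0" unfolding cis_eq_iff_int by auto
    thus ?thesis by (simp add: e)
  qed
  show ?thesis unfolding smooth_free_circle_action_def using 1 2 3 4 smooth_circle_act by blast
qed

lemma zoll_if_closed: "zoll L g B"
  unfolding zoll_def
proof (intro exI[of _ circle_act] conjI allI impI circle_action)
  fix q v assume "g q v v = 1"
  then obtain \<theta>0 where v: "v = (cos \<theta>0, sin \<theta>0 / a (fst q))" by (rule unit_vector_angle)
  obtain x y \<theta> where ode: "ode x y \<theta>" and ini: "x 0 = fst q" "y 0 = snd q" "\<theta> 0 = \<theta>0"
    by (rule ode_exists)
  have qv: "(q, v) = ((x 0, y 0), (cos (\<theta> 0), sin (\<theta> 0) / a (x 0)))" by (simp add: v ini)
  \<comment> \<open>The time change is the angle swept by the velocity; it increases with time and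
    is onto since every angle is reached.\<close>
  define \<tau> where "\<tau> t = \<theta> t - \<theta> 0" for t
  note S = ode_solution[OF ode refl]
  have "strict_mono \<tau>" using ode_strict_mono[OF ode] by (simp add: \<tau>_def strict_mono_def)
  moreover have "surj \<tau>"
  proof -
    have "\<theta> (T (H (x 0) (\<theta> 0)) (\<phi> + \<theta> 0) - T (H (x 0) (\<theta> 0)) (\<theta> 0)) = \<phi> + \<theta> 0" for \<phi>
      using S(3)[of "T (H (x 0) (\<theta> 0)) (\<phi> + \<theta> 0) - T (H (x 0) (\<theta> 0)) (\<theta> 0)"] by (simp add: T_inj)
    hence "\<phi> = \<tau> (T (H (x 0) (\<theta> 0)) (\<phi> + \<theta> 0) - T (H (x 0) (\<theta> 0)) (\<theta> 0))" for \<phi>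
      by (simp add: \<tau>_def)
    thus ?thesis by (rule surjI[OF sym])
  qed
  moreover have "bundle_proj L (magnetic_flow g B t (q, v)) = circle_act (cis (\<tau> t)) (bundle_proj L (q, v))" for t
  proof -
    have "circle_act (cis (\<tau> t)) (bundle_proj L (q, v)) = turn (\<tau> t) (x 0) (y 0) (\<theta> 0)"
      unfolding qv bpt_def[symmetric] by (rule circle_act_cis[OF G_closed])
    also have "\<dots> = bpt (x t) (y t) (\<theta> t)"
      unfolding turn_def S(1)[of t] S(2)[of t] \<tau>_def by simp
    finally show ?thesis unfolding qv magnetic_flow_ode[OF ode] bpt_def by simp
  qed
  ultimately show "\<exists>\<tau>::real \<Rightarrow> real. strict_mono \<tau> \<and> surj \<tau> \<and>
      (\<forall>t. bundle_proj L (magnetic_flow g B t (q, v)) = circle_act (cis (\<tau> t)) (bundle_proj L (q, v)))" by blast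
qed

end

lemma zoll_iff: "zoll L g B \<longleftrightarrow> (\<forall>I. G (I, 2 * pi) = 0)"
  using zoll_imp_closed zoll_if_closed by blast

end

section \<open>The average of the field and the infimum of the magnetic lengths\<close>

context rot_system
begin

lemma integral_rectangle:
  assumes f: "continuous_on UNIV f"
  shows "integral (cbox (0,0) (1,L)) (\<lambda>p. f (fst p)) = L * prim f 1"
proof -
  have "continuous_on (cbox (0,0) (1,L)) (\<lambda>p. f (fst p))"
    by (intro continuous_on_compose2[OF f] continuous_intros) auto
  from integral_prod_continuous[OF this]
  have "integral (cbox (0,0) (1,L)) (\<lambda>p. f (fst p)) = integral {0..1} (\<lambda>x. L * f x)"
    using L_pos by simp
  also have "\<dots> = L * prim f 1"
    using integral_unique[OF prim_has_integral[OF f, of 0 1]] by (simp add: prim_0[OF f])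
  finally show ?thesis .
qed

lemma average_g: "average L g B = A / P 1"
  using integral_rectangle[OF cont_ab] integral_rectangle[OF cont_a] L_pos
  by (simp add: average_def area_form_g A_def F_def P_def mult.commute)

text \<open>The infimum is attained: a minimizing level is critical, hence carries a closed geodesic
  in the class of the fibres, and every length occurring is a value of \<open>J\<close>.\<close>

lemma INF_magnetic_length:
  assumes min: "\<And>I. J I0 \<le> J I" and "G (I0, 2 * pi) = 0"
  shows "(INF c\<in>Lambda_plus_geodesics L g B. ereal (magnetic_length g B c)) = ereal (J I0)"
proof (rule antisym)
  obtain c where "c \<in> Lambda_plus_geodesics L g B" "magnetic_length g B c = J I0"
    using closed_geodesic_exists[OF assms(2)] .
  thus "(INF c\<in>Lambda_plus_geodesics L g B. ereal (magnetic_length g B c)) \<le> ereal (J I0)"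
    by (metis INF_lower)
  show "ereal (J I0) \<le> (INF c\<in>Lambda_plus_geodesics L g B. ereal (magnetic_length g B c))"
    by (rule INF_greatest) (metis closed_geodesic_length ereal_less_eq(3) min)
qed

end

theorem theorem2p2:
  fixes L :: real and a b :: "real \<Rightarrow> real"
    and g :: metric and B :: "plane \<Rightarrow> real"
  defines "g \<equiv> rot_metric a" and "B \<equiv> (\<lambda>p. b (fst p))"
  assumes "L > 0"
    and "smooth_on UNIV a" and "\<And>x. a (x + 1) = a x" and "\<And>x. a x > 0"
    and "smooth_on UNIV b" and "\<And>x. b (x + 1) = b x"
    and "\<And>x. \<bar>deriv a x\<bar> < a x * b x"
  shows "(INF c\<in>Lambda_plus_geodesics L g B. ereal (magnetic_length g B c))
           \<le> ereal (pi / average L g B) \<and>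
         ((INF c\<in>Lambda_plus_geodesics L g B. ereal (magnetic_length g B c))
           = ereal (pi / average L g B) \<longleftrightarrow> zoll L g B)"
proof -
  interpret rot_system L a b
    using assms by unfold_locales (auto simp: smooth_on_UNIV_iff)
  obtain I0 where I0: "\<And>I. J I0 \<le> J I" "G (I0, 2 * pi) = 0" "J I0 \<le> pi * P 1 / A"
    "J I0 = pi * P 1 / A \<longleftrightarrow> (\<forall>I. G (I, 2 * pi) = 0)"
    by (rule J_min) blast
  show ?thesis
    unfolding g_def B_def INF_magnetic_length[OF I0(1,2)] average_g zoll_iff
    using I0(3,4) by simp
qed

end
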